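(* Let $n\ge 3$ and $d \ge 1$ be integers, let $\mathbb{K}$ be a field, and let $A=\mathbb{K}[x_1,\ldots,x_n]/I$ be a standard graded Artinian algebra, with $I$ a homogeneous ideal, whose Betti table has a maximal $(n,d)$-Koszul tail. Then $A$ does not have the Weak Lefschetz Property; moreover, for a general linear form $l$, the multiplication map $A_d \xrightarrow{\ \cdot l\ } A_{d+1}$ does not have full rank.
   Context: For a polynomial ring $R$ over $\mathbb{K}$ (standard graded) and a homogeneous ideal $I\subseteq R$, the Betti table of $R/I$ is the table whose entry in row $j$ and column $i$ is $\beta_{i,i+j} = \dim_{\mathbb{K}} \operatorname{Tor}_i^R(R/I,\mathbb{K})_{i+j}$. A Betti table has an $(n,d)$-Koszul tail if its upper-left block consisting of rows $0,\ldots,d$ and columns $0,\ldots,n$ is as follows: row $0$ has entry $1$ in column $0$ and zeros in columns $1,\ldots,n$; rows $1,\ldots,d-1$ are zero in columns $0,\ldots,n$; row $d$ has entry $0$ in column $0$ and entry $\binom{n}{i}$ in column $i$ for $1\le i\le n$. If moreover the table is the Betti table of an Artinian ring $\mathbb{K}[x_1,\ldots,x_n]/I$ (the number of variables being equal to the same $n$), the tail is called a maximal $(n,d)$-Koszul tail. A standard graded Artinian algebra $A$ has the Weak Lefschetz Property (WLP) if for a general linear form $l$ the multiplication map $\cdot l\colon A_i \to A_{i+1}$ has full rank (that is, is injective or surjective) for all $i\ge 0$. *)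

theory Defs
  imports
    Complex_Main
    "HOL-Algebra.QuotRing"
    "HOL-Decision_Procs.Algebra_Aux"
    "HOL-Library.Poly_Mapping"
    "HOL-Library.Function_Algebras"
    "HOL-Library.Cardinality"
begin

section \<open>The polynomial ring and its quotients\<close>

text \<open>Polynomials over \<open>'k\<close> in the finitely many variables \<open>x\<^sub>v\<close>, \<open>v :: 'v\<close>. A monomial is its
  exponent vector, and a polynomial maps monomials to coefficients; the product is the
  convolution product of \<^theory>\<open>HOL-Library.Poly_Mapping\<close>.\<close>

type_synonym ('v, 'k) mpoly = "('v \<Rightarrow>\<^sub>0 nat) \<Rightarrow>\<^sub>0 'k"

abbreviation poly_ring :: "('v::finite, 'k::field) mpoly ring" where
  "poly_ring \<equiv> cring_class_ops"

definition mdeg :: "('v::finite \<Rightarrow>\<^sub>0 nat) \<Rightarrow> nat" where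
  "mdeg m = (\<Sum>v\<in>UNIV. Poly_Mapping.lookup m v)"

definition graded_part :: "nat \<Rightarrow> ('v::finite, 'k::field) mpoly set" where
  "graded_part j = {p. \<forall>m \<in> Poly_Mapping.keys p. mdeg m = j}"

definition hom_component :: "nat \<Rightarrow> ('v::finite, 'k::field) mpoly \<Rightarrow> ('v, 'k) mpoly" where
  "hom_component j = Poly_Mapping.mapp (\<lambda>m c. if mdeg m = j then c else 0)"

definition homogeneous_ideal :: "('v::finite, 'k::field) mpoly set \<Rightarrow> bool" where
  "homogeneous_ideal I \<longleftrightarrow> ideal I poly_ring \<and> (\<forall>p \<in> I. \<forall>j. hom_component j p \<in> I)"

definition quot_ring :: "('v::finite, 'k::field) mpoly set \<Rightarrow> ('v, 'k) mpoly set ring" where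
  "quot_ring I = poly_ring Quot I"

definition residue_class :: "('v::finite, 'k::field) mpoly set \<Rightarrow> ('v, 'k) mpoly \<Rightarrow> ('v, 'k) mpoly set"
  where "residue_class I p = I +>\<^bsub>poly_ring\<^esub> p"

definition quot_part :: "('v::finite, 'k::field) mpoly set \<Rightarrow> nat \<Rightarrow> ('v, 'k) mpoly set set" where
  "quot_part I j = residue_class I ` graded_part j"

definition artinian_ring :: "('a, 'b) ring_scheme \<Rightarrow> bool" where
  "artinian_ring R \<longleftrightarrow> ring R \<and>
     (\<forall>J :: nat \<Rightarrow> 'a set. (\<forall>k. ideal (J k) R \<and> J (Suc k) \<subseteq> J k) \<longrightarrow> (\<exists>N. \<forall>k\<ge>N. J k = J N))"


section \<open>Graded free resolutions and Betti tables\<close>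

text \<open>The data of a complex \<open>\<dots> \<rightarrow> F\<^sub>2 \<rightarrow> F\<^sub>1 \<rightarrow> F\<^sub>0 \<rightarrow> R/I\<close> of finitely generated graded free modules
  \<open>F\<^sub>i = \<Oplus>\<^bsub>a < rank i\<^esub> R(- shift i a)\<close>. The matrix of \<open>F\<^bsub>i+1\<^esub> \<rightarrow> F\<^sub>i\<close> is \<open>bd i\<close> (first index: row),
  and the basis element \<open>a\<close> of \<open>F\<^sub>0\<close> goes to the class of \<open>aug a\<close>.\<close>

record 'r free_res =
  rank :: "nat \<Rightarrow> nat"
  shift :: "nat \<Rightarrow> nat \<Rightarrow> nat"
  bd :: "nat \<Rightarrow> nat \<Rightarrow> nat \<Rightarrow> 'r"
  aug :: "nat \<Rightarrow> 'r"

definition free_mod :: "nat \<Rightarrow> (nat \<Rightarrow> 'r::zero) set" where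
  "free_mod r = {v. \<forall>a\<ge>r. v a = 0}"

definition mat_apply :: "nat \<Rightarrow> nat \<Rightarrow> (nat \<Rightarrow> nat \<Rightarrow> 'r) \<Rightarrow> (nat \<Rightarrow> 'r) \<Rightarrow> nat \<Rightarrow> 'r::semiring_0" where
  "mat_apply r c M v = (\<lambda>a. if a < r then (\<Sum>b<c. M a b * v b) else 0)"

definition aug_map :: "('v::finite, 'k::field) mpoly free_res \<Rightarrow> (nat \<Rightarrow> ('v, 'k) mpoly) \<Rightarrow> ('v, 'k) mpoly" where
  "aug_map F v = (\<Sum>a<rank F 0. aug F a * v a)"

definition bd_map :: "('v::finite, 'k::field) mpoly free_res \<Rightarrow> nat \<Rightarrow> (nat \<Rightarrow> ('v, 'k) mpoly) \<Rightarrow> nat \<Rightarrow> ('v, 'k) mpoly"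
  where "bd_map F i = mat_apply (rank F i) (rank F (Suc i)) (bd F i)"

text \<open>The first two conditions say that the maps are homogeneous of degree \<open>0\<close>; the other four say
  that \<open>\<dots> \<rightarrow> F\<^sub>1 \<rightarrow> F\<^sub>0 \<rightarrow> R/I \<rightarrow> 0\<close> is exact.\<close>

definition graded_free_resolution ::
    "('v::finite, 'k::field) mpoly set \<Rightarrow> ('v, 'k) mpoly free_res \<Rightarrow> bool" where
  "graded_free_resolution I F \<longleftrightarrow>
     (\<forall>a < rank F 0. aug F a \<in> graded_part (shift F 0 a)) \<and>
     (\<forall>i. \<forall>a < rank F i. \<forall>b < rank F (Suc i). \<forall>m \<in> Poly_Mapping.keys (bd F i a b).
        mdeg m + shift F i a = shift F (Suc i) b) \<and>
     (\<lambda>v. residue_class I (aug_map F v)) ` free_mod (rank F 0) = carrier (quot_ring I) \<and>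
     {v \<in> free_mod (rank F 0). residue_class I (aug_map F v) = \<zero>\<^bsub>quot_ring I\<^esub>}
       = bd_map F 0 ` free_mod (rank F 1) \<and>
     (\<forall>i. {v \<in> free_mod (rank F (Suc i)). bd_map F i v = 0}
            = bd_map F (Suc i) ` free_mod (rank F (Suc (Suc i))))"

text \<open>The complex \<open>F \<otimes>\<^sub>R K\<close>, with \<open>K = R/(x\<^sub>v | v)\<close>: the module \<open>F\<^sub>i \<otimes>\<^sub>R K\<close> is the vector space with
  basis \<open>{..<rank i}\<close>, its degree \<open>j\<close> part is spanned by the basis elements of degree \<open>j\<close>, and
  the differential has as entries the constant coefficients of those of \<open>bd i\<close>.\<close>

definition fibre_part :: "('v::finite, 'k::field) mpoly free_res \<Rightarrow> nat \<Rightarrow> nat \<Rightarrow> (nat \<Rightarrow> 'k) set" where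
  "fibre_part F i j = {v \<in> free_mod (rank F i). \<forall>a. v a \<noteq> 0 \<longrightarrow> shift F i a = j}"

definition fibre_bd :: "('v::finite, 'k::field) mpoly free_res \<Rightarrow> nat \<Rightarrow> (nat \<Rightarrow> 'k) \<Rightarrow> nat \<Rightarrow> 'k" where
  "fibre_bd F i =
     mat_apply (rank F i) (rank F (Suc i)) (\<lambda>a b. Poly_Mapping.lookup (bd F i a b) 0)"

definition tor_cycles :: "('v::finite, 'k::field) mpoly free_res \<Rightarrow> nat \<Rightarrow> nat \<Rightarrow> (nat \<Rightarrow> 'k) set" where
  "tor_cycles F i j =
     {v \<in> fibre_part F i j. case i of 0 \<Rightarrow> True | Suc i' \<Rightarrow> fibre_bd F i' v = 0}"

definition tor_boundaries :: "('v::finite, 'k::field) mpoly free_res \<Rightarrow> nat \<Rightarrow> nat \<Rightarrow> (nat \<Rightarrow> 'k) set" where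
  "tor_boundaries F i j = fibre_bd F i ` fibre_part F (Suc i) j"

abbreviation vec_dim :: "(nat \<Rightarrow> 'k::field) set \<Rightarrow> nat" where
  "vec_dim \<equiv> vector_space.dim (\<lambda>c v a. c * v a)"

text \<open>The dimension of the degree \<open>j\<close> part of \<open>Tor\<^sub>i(R/I, K) = H\<^sub>i(F \<otimes>\<^sub>R K)\<close>, where \<open>F\<close> is a
  resolution of \<open>R/I\<close>; the boundaries are a subspace of the finite-dimensional space of cycles.\<close>

definition tor_dim :: "('v::finite, 'k::field) mpoly free_res \<Rightarrow> nat \<Rightarrow> nat \<Rightarrow> nat" where
  "tor_dim F i j = vec_dim (tor_cycles F i j) - vec_dim (tor_boundaries F i j)"

text \<open>\<open>T j i\<close> is the entry in row \<open>j\<close> and column \<open>i\<close>. Every homogeneous ideal has exactly one Betti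
  table, since a resolution exists and \<open>Tor\<close> does not depend on it. Rows of negative index vanish.\<close>

definition is_betti_table :: "('v::finite, 'k::field) mpoly set \<Rightarrow> (nat \<Rightarrow> nat \<Rightarrow> nat) \<Rightarrow> bool" where
  "is_betti_table I T \<longleftrightarrow>
     (\<exists>F. graded_free_resolution I F \<and> (\<forall>i j. T j i = tor_dim F i (i + j)))"

definition koszul_tail :: "nat \<Rightarrow> nat \<Rightarrow> (nat \<Rightarrow> nat \<Rightarrow> nat) \<Rightarrow> bool" where
  "koszul_tail n d T \<longleftrightarrow>
     T 0 0 = 1 \<and> (\<forall>i\<in>{1..n}. T 0 i = 0) \<and>
     (\<forall>j\<in>{1..<d}. \<forall>i\<in>{0..n}. T j i = 0) \<and>
     T d 0 = 0 \<and> (\<forall>i\<in>{1..n}. T d i = n choose i)"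

text \<open>The tail is maximal: \<open>n\<close> is the number of variables and \<open>R/I\<close> is Artinian.\<close>

definition has_maximal_koszul_tail ::
    "('v::finite, 'k::field) mpoly set \<Rightarrow> nat \<Rightarrow> nat \<Rightarrow> bool" where
  "has_maximal_koszul_tail I n d \<longleftrightarrow>
     n = CARD('v) \<and> artinian_ring (quot_ring I) \<and> (\<exists>T. is_betti_table I T \<and> koszul_tail n d T)"


section \<open>General linear forms and the Weak Lefschetz Property\<close>

definition linear_form :: "('v::finite \<Rightarrow> 'k::field) \<Rightarrow> ('v, 'k) mpoly" where
  "linear_form a = (\<Sum>v\<in>UNIV. Poly_Mapping.single (Poly_Mapping.single v 1) (a v))"

definition mpoly_eval :: "('v::finite, 'k::field) mpoly \<Rightarrow> ('v \<Rightarrow> 'k) \<Rightarrow> 'k" where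
  "mpoly_eval p a =
     (\<Sum>m\<in>Poly_Mapping.keys p. Poly_Mapping.lookup p m * (\<Prod>v\<in>UNIV. a v ^ Poly_Mapping.lookup m v))"

definition zariski_open :: "('v::finite \<Rightarrow> 'k::field) set \<Rightarrow> bool" where
  "zariski_open U \<longleftrightarrow> (\<exists>S. U = {a. \<exists>p\<in>S. mpoly_eval p a \<noteq> 0})"

text \<open>A property holds for a general linear form if it holds on a nonempty Zariski-open set of
  coefficient vectors. If \<open>'k\<close> is finite, every set of coefficient vectors is open.\<close>

definition for_general_linear_form :: "(('v::finite, 'k::field) mpoly \<Rightarrow> bool) \<Rightarrow> bool" where
  "for_general_linear_form P \<longleftrightarrow>
     (\<exists>U. zariski_open U \<and> U \<noteq> {} \<and> (\<forall>a\<in>U. P (linear_form a)))"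

definition mult_full_rank ::
    "('v::finite, 'k::field) mpoly set \<Rightarrow> nat \<Rightarrow> ('v, 'k) mpoly \<Rightarrow> bool" where
  "mult_full_rank I i l \<longleftrightarrow>
     (let f = (\<lambda>x. residue_class I l \<otimes>\<^bsub>quot_ring I\<^esub> x)
      in inj_on f (quot_part I i) \<or> f ` quot_part I i = quot_part I (Suc i))"

definition weak_lefschetz :: "('v::finite, 'k::field) mpoly set \<Rightarrow> bool" where
  "weak_lefschetz I \<longleftrightarrow> for_general_linear_form (\<lambda>l. \<forall>i. mult_full_rank I i l)"

end

theory Submission
  imports Defs "HOL-Computational_Algebra.Polynomial"
begin

text \<open>
  Write \<open>R\<close> for the polynomial ring in \<open>n\<close> variables. The entry \<open>1\<close> in row \<open>d\<close> and column \<open>n\<close> of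
  the Betti table says that \<open>Tor\<^sub>n(R/I, K)\<close> does not vanish in degree \<open>n + d\<close>. The top \<open>Tor\<close> is
  the socle, shifted by \<open>n\<close>: there is a form \<open>f\<close> of degree \<open>d\<close> outside \<open>I\<close> with \<open>x f \<in> I\<close> for
  every variable \<open>x\<close> (lemma \<open>socle_of_top_tor\<close>). Hence \<open>f\<close> is a nonzero element of the kernel of
  multiplication by \<^emph>\<open>any\<close> linear form, and the map from degree \<open>d\<close> to degree \<open>d + 1\<close> is never
  injective.

  Column \<open>1\<close> counts minimal generators. It shows that \<open>I\<close> vanishes in degrees up to \<open>d\<close> and has
  dimension at most \<open>n\<close> in degree \<open>d + 1\<close> (lemma \<open>generators_le_tor_1\<close>). The \<open>n\<close> products \<open>x f\<close>
  are linearly independent, so the degree \<open>d + 1\<close> part of \<open>I\<close> consists of the multiples of \<open>f\<close> by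
  linear forms (lemma \<open>next_degree_eq_linear_multiples\<close>).

  If multiplication by \<open>l\<close> were surjective, then every form of degree \<open>d + 1\<close> would lie in
  \<open>l R + f R\<^sub>1\<close>. Because \<open>n \<ge> 3\<close>, the hyperplane \<open>l = 0\<close> contains a plane; restricting to it and
  setting one coordinate to \<open>1\<close> gives a homomorphism \<open>R \<rightarrow> K[t]\<close> that kills \<open>l\<close>, sends the
  variables to polynomials of degree at most \<open>1\<close>, and has both \<open>1\<close> and \<open>t\<close> among their images. So
  \<open>1\<close> and \<open>t\<^bsup>d+1\<^esup>\<close> would both be the image of \<open>f\<close> times a polynomial of degree at most \<open>1\<close>. The
  first makes the image of \<open>f\<close> a unit, and then the second is impossible because \<open>d + 1 \<ge> 2\<close>.

  The full rank property therefore fails for every linear form, in particular for a general one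
  over any field, finite or not.

  The resolution that computes the Betti table need not be minimal, so the two statements on \<open>Tor\<close>
  are proved by diagram chases in an arbitrary graded free resolution \<open>F\<close>. For the socle, the
  variables are set to zero one after the other: each step is the long exact sequence of
  multiplication by a variable on \<open>F/V F\<close>, where \<open>V\<close> are the variables already set to zero. It
  gives \<open>H\<^sub>i(F/V F) = 0\<close> for \<open>i > |V|\<close> and injections \<open>H\<^sub>i(F/V F) \<rightarrow> \<dots> \<rightarrow> H\<^sub>0(F) = R/I\<close> for
  \<open>i = |V|\<close>. When \<open>V\<close> is the set of all variables the left-hand side is \<open>Tor\<^sub>n(R/I, K)\<close> and is
  killed by all variables, hence so is its image.
\<close>


section \<open>Homogeneous polynomials and ideals generated by variables\<close>

abbreviation var :: "'v::finite \<Rightarrow> ('v, 'k::field) mpoly" where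
  "var x \<equiv> Poly_Mapping.single (Poly_Mapping.single x (Suc 0)) 1"

lemma mdeg_add: "mdeg (m + m') = mdeg m + mdeg m'"
  by (simp add: mdeg_def lookup_add sum.distrib)

lemma mdeg_single: "mdeg (Poly_Mapping.single x k) = k"
  by (simp add: mdeg_def lookup_single when_def)

lemma mdeg_eq_0_iff: "mdeg m = 0 \<longleftrightarrow> m = 0"
  by (auto simp: mdeg_def poly_mapping_eq_iff fun_eq_iff)

lemma mpoly_as_sum: "p = (\<Sum>m\<in>Poly_Mapping.keys p. Poly_Mapping.single m (Poly_Mapping.lookup p m))"
  by (rule poly_mapping_eqI)
    (auto simp: lookup_sum lookup_single when_def not_in_keys_iff_lookup_eq_zero sum.delta)

lemma mpoly_induct [case_names single add]:
  assumes "\<And>m c. P (Poly_Mapping.single m c)" and "\<And>p q. P p \<Longrightarrow> P q \<Longrightarrow> P (p + q)"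
  shows "P (p :: 'a \<Rightarrow>\<^sub>0 'b::comm_monoid_add)"
proof -
  have P0: "P 0" using assms(1)[of undefined 0] by simp
  have "P (\<Sum>m\<in>A. Poly_Mapping.single m (Poly_Mapping.lookup p m))" if "finite A" for A
    using that by (induction A rule: finite_induct) (auto intro: assms P0)
  from this[OF finite_keys] show ?thesis by (metis mpoly_as_sum)
qed

text \<open>This is the degree \<open>j\<close> part of the twisted module \<open>R(-s)\<close>. The condition is stated as a sum
  because \<open>j - s\<close> would be truncated for \<open>j < s\<close>, where the part is \<open>0\<close>.\<close>

definition homog :: "nat \<Rightarrow> nat \<Rightarrow> ('v::finite, 'k::field) mpoly set" where
  "homog s j = {p. \<forall>m \<in> Poly_Mapping.keys p. mdeg m + s = j}"

definition homog_part :: "nat \<Rightarrow> nat \<Rightarrow> ('v::finite, 'k::field) mpoly \<Rightarrow> ('v, 'k) mpoly" where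
  "homog_part s j = Poly_Mapping.mapp (\<lambda>m c. if mdeg m + s = j then c else 0)"

lemma graded_part_eq_homog: "graded_part j = homog 0 j"
  by (simp add: graded_part_def homog_def)

lemma hom_component_eq_homog_part: "hom_component j = homog_part 0 j"
  by (simp add: hom_component_def homog_part_def)

lemma homog_0 [simp]: "0 \<in> homog s j"
  by (simp add: homog_def)

lemma homog_add: "p \<in> homog s j \<Longrightarrow> q \<in> homog s j \<Longrightarrow> p + q \<in> homog s j"
  using keys_add[of p q] by (auto simp: homog_def)

lemma keys_uminus: "Poly_Mapping.keys (- p) = Poly_Mapping.keys (p :: 'a \<Rightarrow>\<^sub>0 'b::ab_group_add)"
  by (auto simp: in_keys_iff)

lemma homog_diff: "p \<in> homog s j \<Longrightarrow> q \<in> homog s j \<Longrightarrow> p - q \<in> homog s j"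
  using homog_add[of p s j "- q"] by (auto simp: homog_def keys_uminus)

lemma homog_sum: "(\<And>a. a \<in> A \<Longrightarrow> f a \<in> homog s j) \<Longrightarrow> sum f A \<in> homog s j"
  by (induction A rule: infinite_finite_induct) (auto intro: homog_add)

lemma homog_mult: "p \<in> homog s t \<Longrightarrow> q \<in> homog t j \<Longrightarrow> p * q \<in> homog s j"
  using keys_mult[of p q] by (fastforce simp: homog_def mdeg_add)

lemma var_in_homog: "var x \<in> homog s (Suc s)"
  by (simp add: homog_def mdeg_single)

lemma lookup_homog_part:
  "Poly_Mapping.lookup (homog_part s j p) m =
     (if mdeg m + s = j then Poly_Mapping.lookup p m else 0)"
  by (auto simp: homog_part_def lookup_mapp when_def in_keys_iff)

lemma homog_part_in: "homog_part s j p \<in> homog s j"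
  by (auto simp: homog_def in_keys_iff lookup_homog_part split: if_splits)

lemma homog_part_add: "homog_part s j (p + q) = homog_part s j p + homog_part s j q"
  by (rule poly_mapping_eqI) (simp add: lookup_homog_part lookup_add)

lemma homog_part_0 [simp]: "homog_part s j 0 = 0"
  by (rule poly_mapping_eqI) (simp add: lookup_homog_part)

lemma homog_part_sum: "homog_part s j (sum f A) = (\<Sum>a\<in>A. homog_part s j (f a))"
  by (induction A rule: infinite_finite_induct) (auto simp: homog_part_add)

lemma homog_part_id: "p \<in> homog s j \<Longrightarrow> homog_part s j p = p"
  by (rule poly_mapping_eqI) (auto simp: lookup_homog_part homog_def in_keys_iff)

lemma homog_part_eq_0I: "(\<And>m. m \<in> Poly_Mapping.keys p \<Longrightarrow> mdeg m + s \<noteq> j) \<Longrightarrow> homog_part s j p = 0"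
  by (rule poly_mapping_eqI) (auto simp: lookup_homog_part in_keys_iff)

text \<open>A homogeneous map \<open>R(-t) \<rightarrow> R(-s)\<close> of degree \<open>0\<close> commutes with the projections to degree
  \<open>j\<close>.\<close>

lemma homog_part_mult:
  assumes "p \<in> homog s t"
  shows "homog_part s j (p * q) = p * homog_part t j q"
proof -
  define q' where "q' = q - homog_part t j q"
  have q: "q = homog_part t j q + q'" by (simp add: q'_def)
  have "homog_part s j (p * q') = 0"
  proof (rule homog_part_eq_0I)
    fix m assume "m \<in> Poly_Mapping.keys (p * q')"
    then obtain a b where m: "m = a + b" "a \<in> Poly_Mapping.keys p" "b \<in> Poly_Mapping.keys q'"
      using keys_mult[of p q'] by auto
    then have "mdeg b + t \<noteq> j"
      by (auto simp: q'_def in_keys_iff lookup_minus lookup_homog_part split: if_splits)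
    with m assms show "mdeg m + s \<noteq> j" by (auto simp: homog_def mdeg_add)
  qed
  moreover have "homog_part s j (p * homog_part t j q) = p * homog_part t j q"
    by (intro homog_part_id homog_mult[OF assms] homog_part_in)
  ultimately have "homog_part s j (p * homog_part t j q + p * q') = p * homog_part t j q"
    by (simp add: homog_part_add)
  moreover have "p * homog_part t j q + p * q' = p * q"
    using q by (metis distrib_left)
  ultimately show ?thesis by simp
qed

text \<open>The ideal generated by the variables in \<open>V\<close>. It is a monomial ideal, so membership can be
  read off the monomials of \<open>p\<close>.\<close>

definition var_ideal :: "'v::finite set \<Rightarrow> ('v, 'k::field) mpoly set" where
  "var_ideal V = {p. \<forall>m \<in> Poly_Mapping.keys p. \<exists>x\<in>V. Poly_Mapping.lookup m x \<noteq> 0}"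

lemma var_ideal_0 [simp]: "0 \<in> var_ideal V"
  by (simp add: var_ideal_def)

lemma var_ideal_empty [simp]: "var_ideal {} = {0 :: ('v::finite, 'k::field) mpoly}"
  by (auto simp: var_ideal_def)

lemma var_ideal_add: "p \<in> var_ideal V \<Longrightarrow> q \<in> var_ideal V \<Longrightarrow> p + q \<in> var_ideal V"
  using keys_add[of p q] by (auto simp: var_ideal_def)

lemma var_ideal_diff: "p \<in> var_ideal V \<Longrightarrow> q \<in> var_ideal V \<Longrightarrow> p - q \<in> var_ideal V"
  using var_ideal_add[of p V "- q"] by (auto simp: var_ideal_def keys_uminus)

lemma var_ideal_sum: "(\<And>a. a \<in> A \<Longrightarrow> f a \<in> var_ideal V) \<Longrightarrow> sum f A \<in> var_ideal V"
  by (induction A rule: infinite_finite_induct) (auto intro: var_ideal_add)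

lemma var_ideal_mult: "q \<in> var_ideal V \<Longrightarrow> p * q \<in> var_ideal V"
proof -
  assume q: "q \<in> var_ideal V"
  show "p * q \<in> var_ideal V"
    unfolding var_ideal_def
  proof safe
    fix m assume "m \<in> Poly_Mapping.keys (p * q)"
    then obtain a b where "m = a + b" "b \<in> Poly_Mapping.keys q" using keys_mult[of p q] by auto
    with q show "\<exists>x\<in>V. Poly_Mapping.lookup m x \<noteq> 0" by (auto simp: var_ideal_def lookup_add)
  qed
qed

lemma var_ideal_mono: "V \<subseteq> W \<Longrightarrow> var_ideal V \<subseteq> var_ideal W"
  by (auto simp: var_ideal_def) blast

lemma var_in_var_ideal: "x \<in> V \<Longrightarrow> var x \<in> var_ideal V"
  by (auto simp: var_ideal_def lookup_single when_def)

lemma lookup_single_mult: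
  fixes p :: "('a::cancel_comm_monoid_add) \<Rightarrow>\<^sub>0 ('b::comm_semiring_0)"
  shows "Poly_Mapping.lookup (Poly_Mapping.single m c * p) (m + m') = c * Poly_Mapping.lookup p m'"
  by (induction p rule: mpoly_induct)
    (auto simp: mult_single lookup_single when_def distrib_left lookup_add)

text \<open>Regularity of the sequence of variables: \<open>x\<close> is a nonzerodivisor modulo the ideal of any
  other variables.\<close>

lemma var_mult_in_var_ideal_iff:
  assumes "x \<notin> V"
  shows "var x * p \<in> var_ideal V \<longleftrightarrow> p \<in> var_ideal V"
proof
  assume a: "var x * p \<in> var_ideal V"
  show "p \<in> var_ideal V"
    unfolding var_ideal_def
  proof safe
    fix m assume "m \<in> Poly_Mapping.keys p"
    then have "Poly_Mapping.single x (Suc 0) + m \<in> Poly_Mapping.keys (var x * p)"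
      by (simp add: in_keys_iff lookup_single_mult)
    with a obtain y where y: "y \<in> V" "Poly_Mapping.lookup (Poly_Mapping.single x (Suc 0) + m) y \<noteq> 0"
      by (auto simp: var_ideal_def)
    with assms have "x \<noteq> y" by auto
    with y show "\<exists>x\<in>V. Poly_Mapping.lookup m x \<noteq> 0"
      by (auto simp: lookup_add lookup_single when_def)
  qed
qed (rule var_ideal_mult)

text \<open>The quotient by \<open>x\<close> collects the terms that contain \<open>x\<close>; it is homogeneous whenever \<open>p\<close> is,
  for all twists at once, and this keeps the later diagram chases inside one degree.\<close>

lemma var_ideal_insert_divide:
  fixes p :: "('v::finite, 'k::field) mpoly"
  assumes "p \<in> var_ideal (insert x V)"
  obtains q where "p - var x * q \<in> var_ideal V"
    and "\<And>s j. p \<in> homog s (Suc j) \<Longrightarrow> q \<in> homog s j" and "p = 0 \<Longrightarrow> q = 0"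
proof -
  define A where "A = {m \<in> Poly_Mapping.keys p. Poly_Mapping.lookup m x \<noteq> 0}"
  have dec: "Poly_Mapping.single x (Suc 0) + (m - Poly_Mapping.single x (Suc 0)) = m" if
      "m \<in> A" for m
    using that by (intro poly_mapping_eqI)
        (auto simp: A_def lookup_add lookup_minus lookup_single when_def)
  define q where "q = (\<Sum>m\<in>A. Poly_Mapping.single (m - Poly_Mapping.single x (Suc 0)) (Poly_Mapping.lookup p m))"
  have "var x * q = (\<Sum>m\<in>A. Poly_Mapping.single m (Poly_Mapping.lookup p m))"
    unfolding q_def sum_distrib_left mult_single by (rule sum.cong) (simp_all only: dec mult_1)
  moreover have "p = (\<Sum>m\<in>A. Poly_Mapping.single m (Poly_Mapping.lookup p m))
      + (\<Sum>m\<in>Poly_Mapping.keys p - A. Poly_Mapping.single m (Poly_Mapping.lookup p m))"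
    (is "_ = ?s + ?t")
  proof -
    have "(\<Sum>m\<in>Poly_Mapping.keys p. Poly_Mapping.single m (Poly_Mapping.lookup p m)) = ?t + ?s"
      by (rule sum.subset_diff) (auto simp: A_def)
    from trans[OF mpoly_as_sum trans[OF this add.commute]] show ?thesis .
  qed
  ultimately have "p - var x * q =
      (\<Sum>m\<in>Poly_Mapping.keys p - A. Poly_Mapping.single m (Poly_Mapping.lookup p m))"
    by (metis add_diff_cancel_left')
  also have "\<dots> \<in> var_ideal V"
    using assms by (intro var_ideal_sum) (auto simp: var_ideal_def A_def)
  finally have 1: "p - var x * q \<in> var_ideal V" .
  have 2: "q \<in> homog s j" if "p \<in> homog s (Suc j)" for s j
    unfolding q_def
  proof (rule homog_sum)
    fix m assume m: "m \<in> A"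
    then have "mdeg m + s = Suc j" using that by (auto simp: A_def homog_def)
    moreover have "mdeg m = Suc (mdeg (m - Poly_Mapping.single x (Suc 0)))"
      using arg_cong[OF dec[OF m], of mdeg] by (simp add: mdeg_add mdeg_single)
    ultimately show "Poly_Mapping.single (m - Poly_Mapping.single x (Suc 0)) (Poly_Mapping.lookup p m) \<in> homog s j"
      by (simp add: homog_def)
  qed
  show ?thesis by (rule that[OF 1 2]) (auto simp: q_def A_def)
qed

lemma var_ideal_UNIV_iff: "p \<in> var_ideal UNIV \<longleftrightarrow> Poly_Mapping.lookup p 0 = 0"
proof -
  have "(\<exists>x. Poly_Mapping.lookup m x \<noteq> 0) \<longleftrightarrow> m \<noteq> 0" for m :: "'a \<Rightarrow>\<^sub>0 nat"
    by (auto simp: poly_mapping_eq_iff fun_eq_iff)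
  then show ?thesis by (auto simp: var_ideal_def in_keys_iff)
qed

text \<open>Taking the constant coefficient is the ring homomorphism \<open>R \<rightarrow> K\<close> with kernel
  \<open>var_ideal UNIV\<close>.\<close>

lemma constant_coeff_mult:
  fixes p q :: "('v::finite, 'k::field) mpoly"
  shows "Poly_Mapping.lookup (p * q) 0 = Poly_Mapping.lookup p 0 * Poly_Mapping.lookup q 0"
proof -
  define p' where "p' = p - Poly_Mapping.single 0 (Poly_Mapping.lookup p 0)"
  have "p' \<in> var_ideal UNIV" by (simp add: p'_def var_ideal_UNIV_iff lookup_minus)
  then have "q * p' \<in> var_ideal UNIV" by (rule var_ideal_mult)
  then have "Poly_Mapping.lookup (p' * q) 0 = 0" by (simp add: var_ideal_UNIV_iff mult.commute)
  moreover have "p * q = p' * q + Poly_Mapping.single 0 (Poly_Mapping.lookup p 0) * q"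
    by (simp add: p'_def algebra_simps)
  ultimately show ?thesis
    using lookup_single_mult[of 0 "Poly_Mapping.lookup p 0" q 0] by (simp add: lookup_add)
qed


section \<open>Setting variables to zero in a free resolution\<close>

definition smul :: "'r::times \<Rightarrow> (nat \<Rightarrow> 'r) \<Rightarrow> nat \<Rightarrow> 'r" where
  "smul p v = (\<lambda>a. p * v a)"

definition var_ideal_vec :: "'v::finite set \<Rightarrow> (nat \<Rightarrow> ('v, 'k::field) mpoly) set" where
  "var_ideal_vec V = {v. \<forall>a. v a \<in> var_ideal V}"

lemma free_mod_diff: "u \<in> free_mod r \<Longrightarrow> v \<in> free_mod r \<Longrightarrow> u - v \<in> free_mod r"
  for u v :: "nat \<Rightarrow> 'r::comm_ring_1"
  by (simp add: free_mod_def)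

lemma free_mod_smul: "v \<in> free_mod r \<Longrightarrow> smul p v \<in> free_mod r"
  for v :: "nat \<Rightarrow> 'r::comm_ring_1"
  by (simp add: free_mod_def smul_def)

lemma free_mod_0 [simp]: "0 \<in> free_mod r"
  by (simp add: free_mod_def)

lemma mat_apply_in_free_mod: "mat_apply r c M v \<in> free_mod r"
  by (simp add: free_mod_def mat_apply_def)

lemma mat_apply_add: "mat_apply r c M (u + v) = mat_apply r c M u + mat_apply r c M v"
  for M :: "nat \<Rightarrow> nat \<Rightarrow> 'r::comm_ring_1"
  by (auto simp: mat_apply_def fun_eq_iff distrib_left sum.distrib)

lemma mat_apply_diff: "mat_apply r c M (u - v) = mat_apply r c M u - mat_apply r c M v"
  for M :: "nat \<Rightarrow> nat \<Rightarrow> 'r::comm_ring_1"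
  by (auto simp: mat_apply_def fun_eq_iff right_diff_distrib sum_subtractf)

lemma mat_apply_smul: "mat_apply r c M (smul p v) = smul p (mat_apply r c M v)"
  for M :: "nat \<Rightarrow> nat \<Rightarrow> 'r::comm_ring_1"
  by (auto simp: mat_apply_def smul_def fun_eq_iff sum_distrib_left mult.left_commute)

lemma smul_diff: "smul p (u - v) = smul p u - smul p v"
  for p :: "'r::comm_ring_1"
  by (auto simp: smul_def fun_eq_iff right_diff_distrib)

lemma smul_commute: "smul p (smul q u) = smul q (smul p u)"
  for p :: "'r::comm_ring_1"
  by (auto simp: smul_def fun_eq_iff mult.left_commute)

lemma mat_apply_var_ideal_vec: "v \<in> var_ideal_vec V \<Longrightarrow> mat_apply r c M v \<in> var_ideal_vec V"
  by (auto simp: var_ideal_vec_def mat_apply_def intro!: var_ideal_sum var_ideal_mult)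

lemma var_ideal_vec_0 [simp]: "0 \<in> var_ideal_vec V"
  by (simp add: var_ideal_vec_def)

lemma var_ideal_vec_empty [simp]: "v \<in> var_ideal_vec {} \<longleftrightarrow> v = 0"
  by (auto simp: var_ideal_vec_def fun_eq_iff)

lemma var_ideal_vec_add: "u \<in> var_ideal_vec V \<Longrightarrow> v \<in> var_ideal_vec V \<Longrightarrow> u + v \<in> var_ideal_vec V"
  by (auto simp: var_ideal_vec_def intro: var_ideal_add)

lemma var_ideal_vec_diff: "u \<in> var_ideal_vec V \<Longrightarrow> v \<in> var_ideal_vec V \<Longrightarrow> u - v \<in> var_ideal_vec V"
  by (auto simp: var_ideal_vec_def intro: var_ideal_diff)

lemma var_ideal_vec_smul: "v \<in> var_ideal_vec V \<Longrightarrow> smul p v \<in> var_ideal_vec V"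
  by (auto simp: var_ideal_vec_def smul_def intro: var_ideal_mult)

lemma var_ideal_vec_mono: "V \<subseteq> W \<Longrightarrow> v \<in> var_ideal_vec V \<Longrightarrow> v \<in> var_ideal_vec W"
  using var_ideal_mono[of V W] by (auto simp: var_ideal_vec_def)

lemma smul_var_in_var_ideal_vec: "x \<in> V \<Longrightarrow> smul (var x) v \<in> var_ideal_vec V"
  unfolding var_ideal_vec_def smul_def by (subst mult.commute)
      (simp add: var_ideal_mult var_in_var_ideal)

lemma smul_var_in_var_ideal_vec_iff:
  "x \<notin> V \<Longrightarrow> smul (var x) v \<in> var_ideal_vec V \<longleftrightarrow> v \<in> var_ideal_vec V"
  using var_mult_in_var_ideal_iff by (auto simp: var_ideal_vec_def smul_def)

lemma var_ideal_vec_insert_divide: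
  fixes v :: "nat \<Rightarrow> ('v::finite, 'k::field) mpoly"
  assumes "v \<in> var_ideal_vec (insert x V)" and "v \<in> free_mod r"
  obtains w where "w \<in> free_mod r" "v - smul (var x) w \<in> var_ideal_vec V"
    and "\<And>a s j. v a \<in> homog s (Suc j) \<Longrightarrow> w a \<in> homog s j"
proof -
  have "\<exists>q. v a - var x * q \<in> var_ideal V \<and> (\<forall>s j. v a \<in> homog s (Suc j) \<longrightarrow> q \<in> homog s j) \<and>
      (v a = 0 \<longrightarrow> q = 0)" for a
  proof -
    have "v a \<in> var_ideal (insert x V)" using assms(1) by (simp add: var_ideal_vec_def)
    then obtain q where "v a - var x * q \<in> var_ideal V"
      "\<And>s j. v a \<in> homog s (Suc j) \<Longrightarrow> q \<in> homog s j" "v a = 0 \<Longrightarrow> q = 0"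
      using var_ideal_insert_divide by blast
    then show ?thesis by blast
  qed
  then obtain w where w: "v a - var x * w a \<in> var_ideal V"
      "v a \<in> homog s (Suc j) \<Longrightarrow> w a \<in> homog s j" "v a = 0 \<Longrightarrow> w a = 0" for a s j
    by metis
  show ?thesis
  proof (rule that[of w])
    show "w \<in> free_mod r" using assms(2) w(3) by (simp add: free_mod_def)
    show "v - smul (var x) w \<in> var_ideal_vec V" using w(1) by (simp add: var_ideal_vec_def smul_def)
  qed (rule w(2))
qed

locale graded_resolution =
  fixes I :: "('v::finite, 'k::field) mpoly set" and F :: "('v, 'k) mpoly free_res"
  assumes homogeneous: "homogeneous_ideal I"
    and resolution: "graded_free_resolution I F"
begin

definition hom_vec :: "nat \<Rightarrow> nat \<Rightarrow> (nat \<Rightarrow> ('v, 'k) mpoly) set" where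
  "hom_vec i j = {v \<in> free_mod (rank F i). \<forall>a. v a \<in> homog (shift F i a) j}"

lemma bd_in_homog:
  "a < rank F i \<Longrightarrow> b < rank F (Suc i) \<Longrightarrow> bd F i a b \<in> homog (shift F i a) (shift F (Suc i) b)"
  using resolution by (simp add: graded_free_resolution_def homog_def)

lemma bd_map_hom_vec: "v \<in> hom_vec (Suc i) j \<Longrightarrow> bd_map F i v \<in> hom_vec i j"
proof -
  assume v: "v \<in> hom_vec (Suc i) j"
  have "bd F i a b * v b \<in> homog (shift F i a) j" if "a < rank F i" "b < rank F (Suc i)" for a b
    by (rule homog_mult[OF bd_in_homog[OF that]]) (use v in \<open>simp add: hom_vec_def\<close>)
  then have "bd_map F i v a \<in> homog (shift F i a) j" for a
    by (auto simp: bd_map_def mat_apply_def intro!: homog_sum)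
  then show ?thesis by (simp add: hom_vec_def bd_map_def mat_apply_in_free_mod)
qed

lemma bd_map_exact:
  assumes "v \<in> free_mod (rank F (Suc i))" "bd_map F i v = 0"
  obtains u where "u \<in> free_mod (rank F (Suc (Suc i)))" "v = bd_map F (Suc i) u"
proof -
  have "{v \<in> free_mod (rank F (Suc i)). bd_map F i v = 0} =
      bd_map F (Suc i) ` free_mod (rank F (Suc (Suc i)))"
    using resolution by (simp add: graded_free_resolution_def)
  then have "v \<in> bd_map F (Suc i) ` free_mod (rank F (Suc (Suc i)))" using assms by blast
  then show ?thesis using that by blast
qed

lemma bd_map_bd_map:
  assumes "u \<in> free_mod (rank F (Suc (Suc i)))"
  shows "bd_map F i (bd_map F (Suc i) u) = 0"
proof -
  have "{v \<in> free_mod (rank F (Suc i)). bd_map F i v = 0} =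
      bd_map F (Suc i) ` free_mod (rank F (Suc (Suc i)))"
    using resolution by (simp add: graded_free_resolution_def)
  then show ?thesis using assms by blast
qed

lemma bd_map_in_free_mod: "bd_map F i v \<in> free_mod (rank F i)"
  by (simp add: bd_map_def mat_apply_in_free_mod)

lemma bd_map_add: "bd_map F i (u + v) = bd_map F i u + bd_map F i v"
  by (simp add: bd_map_def mat_apply_add)

lemma bd_map_diff: "bd_map F i (u - v) = bd_map F i u - bd_map F i v"
  by (simp add: bd_map_def mat_apply_diff)

lemma bd_map_smul: "bd_map F i (smul p v) = smul p (bd_map F i v)"
  by (simp add: bd_map_def mat_apply_smul)

lemma bd_map_var_ideal_vec: "v \<in> var_ideal_vec V \<Longrightarrow> bd_map F i v \<in> var_ideal_vec V"
  by (simp add: bd_map_def mat_apply_var_ideal_vec)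

text \<open>Boundaries and cycles of the complex \<open>F/V F\<close>, represented by vectors of polynomials. In
  position \<open>0\<close> every vector is a cycle.\<close>

definition boundary_mod :: "'v set \<Rightarrow> nat \<Rightarrow> (nat \<Rightarrow> ('v, 'k) mpoly) \<Rightarrow> bool" where
  "boundary_mod V i v \<longleftrightarrow>
     (\<exists>u \<in> free_mod (rank F (Suc i)). v - bd_map F i u \<in> var_ideal_vec V)"

definition cycle_mod :: "'v set \<Rightarrow> nat \<Rightarrow> (nat \<Rightarrow> ('v, 'k) mpoly) \<Rightarrow> bool" where
  "cycle_mod V i v \<longleftrightarrow> (\<forall>i'. i = Suc i' \<longrightarrow> bd_map F i' v \<in> var_ideal_vec V)"

text \<open>The connecting homomorphism of \<open>0 \<rightarrow> F/V F \<rightarrow> F/V F \<rightarrow> F/(V \<union> {x}) F \<rightarrow> 0\<close>, where the first map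
  is multiplication by \<open>x\<close>: the boundary of a cycle modulo \<open>V \<union> {x}\<close> is \<open>x w\<close> modulo \<open>V\<close>, and \<open>w\<close>
  is again a cycle modulo \<open>V\<close> because \<open>x\<close> is a nonzerodivisor. The degree drops by one.\<close>

lemma divide_boundary:
  assumes v: "v \<in> free_mod (rank F (Suc i))"
    and cyc: "bd_map F i v \<in> var_ideal_vec (insert x V)" and x: "x \<notin> V"
  obtains w where "w \<in> free_mod (rank F i)" "bd_map F i v - smul (var x) w \<in> var_ideal_vec V"
    "cycle_mod V i w" "\<And>j. v \<in> hom_vec (Suc i) (Suc j) \<Longrightarrow> w \<in> hom_vec i j"
proof -
  obtain w where w: "w \<in> free_mod (rank F i)" "bd_map F i v - smul (var x) w \<in> var_ideal_vec V"
    and hom: "\<And>a s j. bd_map F i v a \<in> homog s (Suc j) \<Longrightarrow> w a \<in> homog s j"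
    using var_ideal_vec_insert_divide[OF cyc bd_map_in_free_mod] by blast
  have "cycle_mod V i w"
    unfolding cycle_mod_def
  proof safe
    fix i' assume i: "i = Suc i'"
    have "bd_map F i' (bd_map F i v) - bd_map F i' (bd_map F i v - smul (var x) w) =
        smul (var x) (bd_map F i' w)"
      by (simp add: bd_map_diff bd_map_smul)
    moreover have "bd_map F i' (bd_map F i v) = 0"
      using bd_map_bd_map v i by simp
    ultimately have "smul (var x) (bd_map F i' w) \<in> var_ideal_vec V"
      using bd_map_var_ideal_vec[OF w(2)] by (metis var_ideal_vec_0 var_ideal_vec_diff)
    then show "bd_map F i' w \<in> var_ideal_vec V"
      by (simp only: smul_var_in_var_ideal_vec_iff[OF x])
  qed
  moreover have "w \<in> hom_vec i j" if "v \<in> hom_vec (Suc i) (Suc j)" for j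
    using bd_map_hom_vec[OF that] w(1) hom by (auto simp: hom_vec_def)
  ultimately show ?thesis using that w by blast
qed

text \<open>Exactness at the source of the connecting homomorphism: here \<open>w\<close> is the image of \<open>v\<close>, and if
  it is a boundary modulo \<open>V\<close>, a multiple of \<open>x\<close> corrects \<open>v\<close> to a cycle modulo \<open>V\<close>.\<close>

lemma bd_map_correct:
  assumes "bd_map F i v - smul (var x) w \<in> var_ideal_vec V" and "w - bd_map F i u \<in> var_ideal_vec V"
  shows "bd_map F i (v - smul (var x) u) \<in> var_ideal_vec V"
proof -
  have "bd_map F i (v - smul (var x) u) =
      (bd_map F i v - smul (var x) w) + smul (var x) (w - bd_map F i u)"
    by (simp add: bd_map_diff bd_map_smul smul_diff)
  then show ?thesis using assms by (auto intro: var_ideal_vec_add var_ideal_vec_smul)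
qed

lemma boundary_mod_insert:
  assumes "boundary_mod V i (v - smul (var x) u)"
  shows "boundary_mod (insert x V) i v"
proof -
  obtain u' where u': "u' \<in> free_mod (rank F (Suc i))"
      "v - smul (var x) u - bd_map F i u' \<in> var_ideal_vec V"
    using assms by (auto simp: boundary_mod_def)
  have "(v - smul (var x) u - bd_map F i u') + smul (var x) u \<in> var_ideal_vec (insert x V)"
    using u'(2) by (intro var_ideal_vec_add smul_var_in_var_ideal_vec)
      (auto intro: var_ideal_vec_mono[rotated])
  then have "v - bd_map F i u' \<in> var_ideal_vec (insert x V)" by (simp add: algebra_simps)
  with u'(1) show ?thesis by (auto simp: boundary_mod_def)
qed

text \<open>Exactness of \<open>F\<close> in positive positions survives in \<open>F/V F\<close> above position \<open>|V|\<close>: each new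
  variable costs at most one position, by the long exact sequence.\<close>

lemma cycle_mod_imp_boundary_mod:
  assumes "finite V" and "card V \<le> i" and "v \<in> free_mod (rank F (Suc i))"
    and "bd_map F i v \<in> var_ideal_vec V"
  shows "boundary_mod V (Suc i) v"
  using assms
proof (induction V arbitrary: i v rule: finite_induct)
  case empty
  then obtain u where "u \<in> free_mod (rank F (Suc (Suc i)))" "v = bd_map F (Suc i) u"
    using bd_map_exact[of v i] by auto
  then show ?case by (auto simp: boundary_mod_def)
next
  case (insert x V)
  then obtain i' where i: "i = Suc i'" by (cases i) auto
  obtain w where w: "w \<in> free_mod (rank F i)" "bd_map F i v - smul (var x) w \<in> var_ideal_vec V"
      "cycle_mod V i w"
    using divide_boundary[OF insert.prems(2,3) insert.hyps(2)] by blast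
  have "boundary_mod V i w"
    unfolding i by (rule insert.IH) (use insert w i in \<open>auto simp: cycle_mod_def\<close>)
  then obtain u where u: "u \<in> free_mod (rank F (Suc i))" "w - bd_map F i u \<in> var_ideal_vec V"
    by (auto simp: boundary_mod_def)
  have "boundary_mod V (Suc i) (v - smul (var x) u)"
  proof (rule insert.IH)
    show "card V \<le> i" using insert by simp
    show "v - smul (var x) u \<in> free_mod (rank F (Suc i))"
      by (intro free_mod_diff free_mod_smul insert.prems u)
    show "bd_map F i (v - smul (var x) u) \<in> var_ideal_vec V" by (rule bd_map_correct[OF w(2) u(2)])
  qed
  then show ?case by (rule boundary_mod_insert)
qed

text \<open>Iterating the connecting homomorphism along the variables in \<open>V\<close> sends classes of
  \<open>H\<^sub>i(F/V F)\<close>, \<open>i = |V|\<close>, to classes of \<open>H\<^sub>0(F)\<close>. Each step is injective, because the homology in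
  position \<open>|V| + 1\<close> vanishes before the next variable is set to zero, and \<open>R\<close>-linear, so a class
  killed by all variables keeps this property.\<close>

lemma cycle_descends_to_socle:
  assumes "finite V" and "v \<in> hom_vec (card V) (j + card V)" and "cycle_mod V (card V) v"
    and "\<not> boundary_mod V (card V) v" and "\<And>y. boundary_mod V (card V) (smul (var y) v)"
  shows "\<exists>w \<in> hom_vec 0 j. \<not> boundary_mod {} 0 w \<and> (\<forall>y. boundary_mod {} 0 (smul (var y) w))"
  using assms
proof (induction V arbitrary: v rule: finite_induct)
  case empty
  then show ?case by (intro bexI[of _ v]) simp_all
next
  case (insert x V)
  define i where "i = card V"
  have card: "card (insert x V) = Suc i" using insert.hyps by (simp add: i_def)
  note prems = insert.prems[unfolded card]
  have v: "v \<in> free_mod (rank F (Suc i))" using prems(1) by (simp add: hom_vec_def)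
  have "bd_map F i v \<in> var_ideal_vec (insert x V)" using prems(2) by (simp add: cycle_mod_def)
  then obtain w where w: "w \<in> free_mod (rank F i)" "bd_map F i v - smul (var x) w \<in> var_ideal_vec V"
      "cycle_mod V i w" "\<And>j. v \<in> hom_vec (Suc i) (Suc j) \<Longrightarrow> w \<in> hom_vec i j"
    using divide_boundary[OF v _ insert.hyps(2)] by blast
  show ?case
  proof (rule insert.IH)
    show "w \<in> hom_vec (card V) (j + card V)" using w(4) prems(1) by (simp add: i_def)
    show "cycle_mod V (card V) w" using w(3) by (simp add: i_def)
    show "\<not> boundary_mod V (card V) w"
    proof
      assume "boundary_mod V (card V) w"
      then obtain u where u: "u \<in> free_mod (rank F (Suc i))" "w - bd_map F i u \<in> var_ideal_vec V"
        by (auto simp: boundary_mod_def i_def)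
      \<comment> \<open>Injectivity: were \<open>w\<close> a boundary, \<open>v\<close> would be one after correction by a multiple of
        \<open>x\<close>.\<close>
      have "boundary_mod V (Suc i) (v - smul (var x) u)"
        using insert.hyps by (intro cycle_mod_imp_boundary_mod free_mod_diff free_mod_smul
          bd_map_correct[OF w(2) u(2)] v u) (auto simp: i_def)
      with prems(3) show False by (blast dest: boundary_mod_insert)
    qed
    fix y
    obtain u where u: "u \<in> free_mod (rank F (Suc (Suc i)))"
        "smul (var y) v - bd_map F (Suc i) u \<in> var_ideal_vec (insert x V)"
      using prems(4)[of y] by (auto simp: boundary_mod_def)
    have "smul (var y) v - bd_map F (Suc i) u \<in> free_mod (rank F (Suc i))"
      by (intro free_mod_diff free_mod_smul v bd_map_in_free_mod)
    from var_ideal_vec_insert_divide[OF u(2) this] obtain s where s: "s \<in> free_mod (rank F (Suc i))"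
        "smul (var y) v - bd_map F (Suc i) u - smul (var x) s \<in> var_ideal_vec V"
      by metis
    \<comment> \<open>Linearity: \<open>y w\<close> differs from a boundary by an element that \<open>x\<close> multiplies into \<open>V F\<close>; then
      \<open>x\<close> can be cancelled.\<close>
    have "smul (var x) (smul (var y) w - bd_map F i s) =
        bd_map F i (smul (var y) v - bd_map F (Suc i) u - smul (var x) s)
        - smul (var y) (bd_map F i v - smul (var x) w)"
      using u(1) by (simp add: bd_map_diff bd_map_smul bd_map_bd_map smul_diff smul_commute)
    also have "\<dots> \<in> var_ideal_vec V"
      by (rule var_ideal_vec_diff[OF bd_map_var_ideal_vec[OF s(2)] var_ideal_vec_smul[OF w(2)]])
    finally have "smul (var y) w - bd_map F i s \<in> var_ideal_vec V"
      by (simp only: smul_var_in_var_ideal_vec_iff[OF insert.hyps(2)])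
    with s(1) show "boundary_mod V (card V) (smul (var y) w)"
      by (auto simp: boundary_mod_def i_def)
  qed
qed

end


section \<open>Dimension counts in coordinate spaces\<close>

text \<open>The vector space whose dimension function is \<open>vec_dim\<close>. It is infinite-dimensional, so
  dimensions are compared inside its finite-dimensional subspaces \<open>free_mod r\<close>.\<close>

lemma vector_space_fun: "vector_space (\<lambda>(c::'k::field) (v::nat \<Rightarrow> 'k) a. c * v a)"
  by unfold_locales (auto simp: fun_eq_iff algebra_simps)

lemma sum_fun_apply: "(\<Sum>i\<in>A. f i) x = (\<Sum>i\<in>A. f i x)"
  for f :: "'i \<Rightarrow> 'a \<Rightarrow> 'b::comm_monoid_add"
  by (induction A rule: infinite_finite_induct) auto

lemma free_mod_finite_span:
  "\<exists>C. finite C \<and> free_mod r \<subseteq> module.span (\<lambda>(c::'k::field) (v::nat \<Rightarrow> 'k) a. c * v a) C"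
proof -
  interpret vector_space "\<lambda>(c::'k) (v::nat \<Rightarrow> 'k) a. c * v a" by (rule vector_space_fun)
  define e where "e = (\<lambda>(b::nat) a. if a = b then 1 else 0 :: 'k)"
  have "v \<in> span (e ` {..<r})" if "v \<in> free_mod r" for v
  proof -
    have "v = (\<Sum>b<r. (\<lambda>a. v b * e b a))"
      using that by (auto simp: fun_eq_iff free_mod_def e_def sum_fun_apply sum.delta if_distrib not_less cong: if_cong)
    also have "\<dots> \<in> span (e ` {..<r})"
      by (intro span_sum span_scale span_base) auto
    finally show ?thesis .
  qed
  then show ?thesis by (intro exI[of _ "e ` {..<r}"]) auto
qed

lemma card_independent_le_vec_dim:
  fixes A Z :: "(nat \<Rightarrow> 'k::field) set"
  assumes "\<not> module.dependent (\<lambda>c v a. c * v a) A" and "A \<subseteq> Z" and "Z \<subseteq> free_mod r"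
  shows "card A \<le> vec_dim Z"
proof -
  interpret vector_space "\<lambda>(c::'k) (v::nat \<Rightarrow> 'k) a. c * v a" by (rule vector_space_fun)
  obtain E where E: "finite E" "free_mod r \<subseteq> span E" using free_mod_finite_span by blast
  obtain C where C: "C \<subseteq> Z" "independent C" "Z \<subseteq> span C" "card C = dim Z"
    using basis_exists by blast
  have "finite C" using independent_span_bound[OF E(1) C(2)] C(1) assms(3) E(2) by auto
  with independent_span_bound[OF this, of A] assms C show ?thesis by auto
qed

lemma vec_dim_mono:
  fixes B Z :: "(nat \<Rightarrow> 'k::field) set"
  assumes "B \<subseteq> Z" and "Z \<subseteq> free_mod r"
  shows "vec_dim B \<le> vec_dim Z"
proof -
  interpret vector_space "\<lambda>(c::'k) (v::nat \<Rightarrow> 'k) a. c * v a" by (rule vector_space_fun)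
  obtain C where C: "C \<subseteq> B" "independent C" "B \<subseteq> span C" "card C = dim B"
    using basis_exists by blast
  with card_independent_le_vec_dim[of C Z r] assms show ?thesis by auto
qed

text \<open>The vectors \<open>z i\<close> are linearly independent modulo \<open>B\<close>; a basis of \<open>B\<close> together with them is
  therefore an independent subset of \<open>Z\<close>.\<close>

lemma vec_dim_add_card_le:
  fixes B Z :: "(nat \<Rightarrow> 'k::field) set" and z :: "'i \<Rightarrow> nat \<Rightarrow> 'k"
  assumes B: "module.subspace (\<lambda>c v a. c * v a) B" and "B \<subseteq> Z" and "Z \<subseteq> free_mod r"
    and "finite N" and z: "\<And>i. i \<in> N \<Longrightarrow> z i \<in> Z"
    and indep: "\<And>c. (\<Sum>i\<in>N. (\<lambda>a. c i * z i a)) \<in> B \<Longrightarrow> \<forall>i\<in>N. c i = 0"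
  shows "vec_dim B + card N \<le> vec_dim Z"
proof -
  interpret vector_space "\<lambda>(c::'k) (v::nat \<Rightarrow> 'k) a. c * v a" by (rule vector_space_fun)
  obtain E where E: "finite E" "free_mod r \<subseteq> span E" using free_mod_finite_span by blast
  \<comment> \<open>The last conjunct describes the span of the independent set built so far as contained in \<open>B\<close>
    plus the span of the \<open>z i\<close>, \<open>i \<in> M\<close>; it shows that the next vector is new.\<close>
  have "\<exists>A. independent A \<and> finite A \<and> A \<subseteq> Z \<and> card A = dim B + card M \<and>
      (\<forall>x \<in> span A. \<exists>c. x - (\<Sum>i\<in>M. (\<lambda>a. c i * z i a)) \<in> B)" if "M \<subseteq> N" for M
  proof -
    have "finite M" using that \<open>finite N\<close> finite_subset by blast
    then show ?thesis using that
    proof (induction M rule: finite_induct)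
      case empty
      obtain C where C: "C \<subseteq> B" "independent C" "B \<subseteq> span C" "card C = dim B"
        using basis_exists by blast
      have "span C \<subseteq> B" using C(1) B span_minimal by blast
      moreover have "finite C"
        using independent_span_bound[OF E(1) C(2)] C(1) assms(2,3) E(2) by auto
      ultimately show ?case using C assms(2) by (intro exI[of _ C]) auto
    next
      case (insert n M)
      then have "M \<subseteq> N" by simp
      from insert.IH[OF this] obtain A where A: "independent A" "finite A" "A \<subseteq> Z"
          "card A = dim B + card M"
        and sp: "\<forall>x \<in> span A. \<exists>c. x - (\<Sum>i\<in>M. (\<lambda>a. c i * z i a)) \<in> B"
        by blast
      have new: "z n \<notin> span A"
      proof
        assume "z n \<in> span A"
        then obtain c where c: "z n - (\<Sum>i\<in>M. (\<lambda>a. c i * z i a)) \<in> B" using sp by blast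
        define c' where "c' = (\<lambda>i. if i = n then 1 else if i \<in> M then - c i else 0)"
        have "(\<Sum>i\<in>N. (\<lambda>a. c' i * z i a)) = (\<Sum>i\<in>insert n M. (\<lambda>a. c' i * z i a))"
          using insert.prems \<open>finite N\<close> by (intro sum.mono_neutral_right)
              (auto simp: c'_def fun_eq_iff)
        also have "\<dots> = z n + (\<Sum>i\<in>M. (\<lambda>a. c' i * z i a))"
          using insert.hyps by (simp add: c'_def)
        also have "(\<Sum>i\<in>M. (\<lambda>a. c' i * z i a)) = (\<Sum>i\<in>M. - (\<lambda>a. c i * z i a))"
          using insert.hyps by (intro sum.cong) (auto simp: c'_def fun_eq_iff)
        finally have "(\<Sum>i\<in>N. (\<lambda>a. c' i * z i a)) = z n - (\<Sum>i\<in>M. (\<lambda>a. c i * z i a))"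
          by (simp only: sum_negf add_uminus_conv_diff)
        with c have "(\<Sum>i\<in>N. (\<lambda>a. c' i * z i a)) \<in> B" by (simp only:)
        then have "c' n = 0" using indep insert.prems by blast
        then show False by (simp add: c'_def)
      qed
      show ?case
      proof (intro exI[of _ "insert (z n) A"] conjI ballI)
        show "independent (insert (z n) A)" using new A(1) by (rule independent_insertI)
        show "card (insert (z n) A) = dim B + card (insert n M)"
          using A insert.hyps new span_base by (subst card_insert_disjoint) auto
        fix x assume "x \<in> span (insert (z n) A)"
        then obtain k where "x - (\<lambda>a. k * z n a) \<in> span A" unfolding span_breakdown_eq by blast
        then obtain c where c: "x - (\<lambda>a. k * z n a) - (\<Sum>i\<in>M. (\<lambda>a. c i * z i a)) \<in> B"
          using sp by blast
        have "(\<Sum>i\<in>M. (\<lambda>a. (c(n := k)) i * z i a)) = (\<Sum>i\<in>M. (\<lambda>a. c i * z i a))"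
          using insert.hyps by (intro sum.cong) auto
        then have "(\<Sum>i\<in>insert n M. (\<lambda>a. (c(n := k)) i * z i a)) =
            (\<lambda>a. k * z n a) + (\<Sum>i\<in>M. (\<lambda>a. c i * z i a))"
          using insert.hyps by (simp only: sum.insert fun_upd_same if_True not_False_eq_True)
        then have "x - (\<Sum>i\<in>insert n M. (\<lambda>a. (c(n := k)) i * z i a)) \<in> B"
          using c by (simp only: diff_diff_add)
        then show "\<exists>c. x - (\<Sum>i\<in>insert n M. (\<lambda>a. c i * z i a)) \<in> B" by blast
      qed (use A z insert.prems in auto)
    qed
  qed
  then obtain A where "independent A" "A \<subseteq> Z" "card A = dim B + card N" by blast
  with card_independent_le_vec_dim[of A Z r] assms(3) show ?thesis by auto
qed


section \<open>The top Tor and the socle\<close>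

lemma residue_class_eq: "residue_class I p = {h + p | h. h \<in> I}"
  by (auto simp: residue_class_def a_r_coset_def r_coset_def cring_class_ops_def)

context
  fixes I :: "('v::finite, 'k::field) mpoly set"
  assumes ideal: "ideal I poly_ring"
begin

lemma ideal_0: "0 \<in> I"
  using additive_subgroup.zero_closed[OF ideal.axioms(1)[OF ideal]] by (simp add: class_simps)

lemma ideal_add: "p \<in> I \<Longrightarrow> q \<in> I \<Longrightarrow> p + q \<in> I"
  using additive_subgroup.a_closed[OF ideal.axioms(1)[OF ideal], of p q] by (simp add: class_simps)

lemma ideal_mult: "p \<in> I \<Longrightarrow> q * p \<in> I"
  using ideal.I_l_closed[OF ideal, of p q] by (simp add: class_simps)

lemma ideal_diff: "p \<in> I \<Longrightarrow> q \<in> I \<Longrightarrow> p - q \<in> I"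
  using ideal_add[of p "- 1 * q"] ideal_mult[of q "- 1"] by simp

lemma ideal_sum: "(\<And>a. a \<in> A \<Longrightarrow> f a \<in> I) \<Longrightarrow> sum f A \<in> I"
  by (induction A rule: infinite_finite_induct) (auto intro: ideal_0 ideal_add)

lemma residue_class_eq_iff: "residue_class I p = residue_class I q \<longleftrightarrow> p - q \<in> I"
proof
  assume "residue_class I p = residue_class I q"
  moreover have "p \<in> residue_class I p" using ideal_0 by (auto simp: residue_class_eq)
  ultimately show "p - q \<in> I" by (auto simp: residue_class_eq)
next
  have sub: "residue_class I p \<subseteq> residue_class I q" if pq: "p - q \<in> I" for p q
  proof
    fix r assume "r \<in> residue_class I p"
    then obtain h where h: "h \<in> I" "r = h + p" by (auto simp: residue_class_eq)
    then have "r = (h + (p - q)) + q" by simp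
    with h pq ideal_add show "r \<in> residue_class I q" unfolding residue_class_eq by blast
  qed
  assume pq: "p - q \<in> I"
  then have "q - p \<in> I" using ideal_diff[OF ideal_0 pq] by simp
  with pq sub show "residue_class I p = residue_class I q" by blast
qed

lemma residue_class_eq_zero_iff: "residue_class I p = \<zero>\<^bsub>quot_ring I\<^esub> \<longleftrightarrow> p \<in> I"
proof -
  have "\<zero>\<^bsub>quot_ring I\<^esub> = residue_class I 0"
    by (simp add: quot_ring_def FactRing_def residue_class_eq)
  then show ?thesis using residue_class_eq_iff[of p 0] by simp
qed

lemma residue_class_mult:
  "residue_class I p \<otimes>\<^bsub>quot_ring I\<^esub> residue_class I q = residue_class I (p * q)"
  using ideal.rcoset_mult_add[OF ideal, of p q]
  by (simp add: quot_ring_def FactRing_def residue_class_def class_simps)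

lemma residue_class_in_carrier: "residue_class I p \<in> carrier (quot_ring I)"
  by (auto simp: quot_ring_def FactRing_def residue_class_def A_RCOSETS_def' cring_class_ops_def)

end

text \<open>The \<open>k\<close>-th power of the ideal generated by all variables. The inclusion \<open>I \<subseteq> order_ge k\<close>
  expresses that the homogeneous ideal \<open>I\<close> vanishes in degrees below \<open>k\<close>.\<close>

definition order_ge :: "nat \<Rightarrow> ('v::finite, 'k::field) mpoly set" where
  "order_ge k = {p. \<forall>m \<in> Poly_Mapping.keys p. k \<le> mdeg m}"

lemma order_ge_0 [simp]: "0 \<in> order_ge k"
  by (simp add: order_ge_def)

lemma order_ge_add: "p \<in> order_ge k \<Longrightarrow> q \<in> order_ge k \<Longrightarrow> p + q \<in> order_ge k"
  using keys_add[of p q] by (auto simp: order_ge_def)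

lemma order_ge_sum: "(\<And>a. a \<in> A \<Longrightarrow> f a \<in> order_ge k) \<Longrightarrow> sum f A \<in> order_ge k"
  by (induction A rule: infinite_finite_induct) (auto intro: order_ge_add)

lemma order_ge_mult:
  assumes "p \<in> order_ge k" and "q \<in> order_ge l"
  shows "p * q \<in> order_ge (k + l)"
  unfolding order_ge_def
proof safe
  fix m assume "m \<in> Poly_Mapping.keys (p * q)"
  then obtain a b where "m = a + b" "a \<in> Poly_Mapping.keys p" "b \<in> Poly_Mapping.keys q"
    using keys_mult[of p q] by auto
  with assms show "k + l \<le> mdeg m" by (auto simp: order_ge_def mdeg_add intro: add_mono)
qed

lemma order_ge_Suc_homog_eq_0:
  assumes "p \<in> order_ge (Suc j)" and "p \<in> homog 0 j"
  shows "p = 0"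
proof -
  have "Poly_Mapping.keys p = {}" using assms by (fastforce simp: order_ge_def homog_def)
  then show ?thesis by simp
qed

lemma order_ge_1_iff: "p \<in> order_ge 1 \<longleftrightarrow> Poly_Mapping.lookup p 0 = 0"
proof -
  have "1 \<le> mdeg m \<longleftrightarrow> m \<noteq> 0" for m :: "'a \<Rightarrow>\<^sub>0 nat"
    using mdeg_eq_0_iff[of m] by linarith
  then show ?thesis unfolding order_ge_def mem_Collect_eq by (metis in_keys_iff)
qed

lemma homog_part_var_ideal: "p \<in> var_ideal V \<Longrightarrow> homog_part s j p \<in> var_ideal V"
  by (auto simp: var_ideal_def in_keys_iff lookup_homog_part split: if_splits)

text \<open>Reduction of a free module over \<open>R\<close> modulo all variables.\<close>

definition const_coeffs :: "(nat \<Rightarrow> ('v::finite, 'k::field) mpoly) \<Rightarrow> nat \<Rightarrow> 'k" where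
  "const_coeffs v = (\<lambda>a. Poly_Mapping.lookup (v a) 0)"

lemma var_ideal_vec_UNIV_iff: "v \<in> var_ideal_vec UNIV \<longleftrightarrow> const_coeffs v = 0"
  by (auto simp: var_ideal_vec_def const_coeffs_def var_ideal_UNIV_iff fun_eq_iff)

lemma const_coeffs_diff: "const_coeffs (u - v) = const_coeffs u - const_coeffs v"
  by (auto simp: const_coeffs_def fun_eq_iff lookup_minus)

lemma const_coeffs_single: "const_coeffs (\<lambda>a. Poly_Mapping.single 0 (z a)) = z"
  by (simp add: const_coeffs_def)

lemma const_coeffs_0 [simp]: "const_coeffs 0 = 0"
  by (simp add: const_coeffs_def fun_eq_iff)

lemma fibre_bd_const_coeffs: "fibre_bd F i (const_coeffs v) = const_coeffs (bd_map F i v)"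
  by (auto simp: fibre_bd_def bd_map_def mat_apply_def const_coeffs_def lookup_sum constant_coeff_mult)

context graded_resolution
begin

lemma ideal_I: "ideal I poly_ring"
  using homogeneous by (simp add: homogeneous_ideal_def)

lemma homog_part_in_I: "p \<in> I \<Longrightarrow> homog_part 0 j p \<in> I"
  using homogeneous by (simp add: homogeneous_ideal_def hom_component_eq_homog_part)

lemma aug_in_homog: "a < rank F 0 \<Longrightarrow> aug F a \<in> homog 0 (shift F 0 a)"
  using resolution by (simp add: graded_free_resolution_def graded_part_eq_homog)

lemma aug_map_in_I_iff:
  assumes "v \<in> free_mod (rank F 0)"
  shows "aug_map F v \<in> I \<longleftrightarrow> (\<exists>u \<in> free_mod (rank F 1). v = bd_map F 0 u)"
proof -
  have "{v \<in> free_mod (rank F 0). residue_class I (aug_map F v) = \<zero>\<^bsub>quot_ring I\<^esub>}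
       = bd_map F 0 ` free_mod (rank F 1)"
    using resolution by (simp add: graded_free_resolution_def)
  with assms show ?thesis unfolding residue_class_eq_zero_iff[OF ideal_I] by blast
qed

lemma aug_map_surj:
  obtains v where "v \<in> free_mod (rank F 0)" "p - aug_map F v \<in> I"
proof -
  have "residue_class I p \<in> (\<lambda>v. residue_class I (aug_map F v)) ` free_mod (rank F 0)"
    using resolution residue_class_in_carrier[OF ideal_I] by (simp add: graded_free_resolution_def)
  then show ?thesis using that residue_class_eq_iff[OF ideal_I] by blast
qed

lemma aug_map_smul: "aug_map F (smul p v) = p * aug_map F v"
  by (simp add: aug_map_def smul_def sum_distrib_left mult.left_commute)

lemma aug_map_homog: "v \<in> hom_vec 0 j \<Longrightarrow> aug_map F v \<in> homog 0 j"
  unfolding aug_map_def by (intro homog_sum homog_mult[OF aug_in_homog]) (auto simp: hom_vec_def)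

definition hom_proj :: "nat \<Rightarrow> nat \<Rightarrow> (nat \<Rightarrow> ('v, 'k) mpoly) \<Rightarrow> nat \<Rightarrow> ('v, 'k) mpoly" where
  "hom_proj i j v = (\<lambda>a. homog_part (shift F i a) j (v a))"

lemma hom_proj_in: "v \<in> free_mod (rank F i) \<Longrightarrow> hom_proj i j v \<in> hom_vec i j"
  by (simp add: hom_proj_def hom_vec_def free_mod_def homog_part_in)

lemma hom_proj_id: "v \<in> hom_vec i j \<Longrightarrow> hom_proj i j v = v"
  by (simp add: hom_proj_def hom_vec_def homog_part_id fun_eq_iff)

lemma bd_map_hom_proj: "bd_map F i (hom_proj (Suc i) j v) = hom_proj i j (bd_map F i v)"
  by (auto simp: fun_eq_iff bd_map_def mat_apply_def hom_proj_def homog_part_sum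
    homog_part_mult[OF bd_in_homog])

lemma aug_map_hom_proj: "aug_map F (hom_proj 0 j v) = homog_part 0 j (aug_map F v)"
  by (auto simp: aug_map_def hom_proj_def homog_part_sum homog_part_mult[OF aug_in_homog])

lemma hom_proj_diff: "hom_proj i j (u - v) = hom_proj i j u - hom_proj i j v"
  by (auto simp: hom_proj_def fun_eq_iff intro!: poly_mapping_eqI simp: lookup_homog_part lookup_minus)

lemma hom_proj_var_ideal_vec: "v \<in> var_ideal_vec V \<Longrightarrow> hom_proj i j v \<in> var_ideal_vec V"
  by (simp add: var_ideal_vec_def hom_proj_def homog_part_var_ideal)

lemma single_in_hom_vec:
  "z \<in> fibre_part F i j \<Longrightarrow> (\<lambda>a. Poly_Mapping.single 0 (z a)) \<in> hom_vec i j"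
  by (auto simp: fibre_part_def hom_vec_def free_mod_def homog_def mdeg_def)

lemma const_coeffs_in_fibre_part: "v \<in> hom_vec i j \<Longrightarrow> const_coeffs v \<in> fibre_part F i j"
proof -
  assume v: "v \<in> hom_vec i j"
  have "shift F i a = j" if "Poly_Mapping.lookup (v a) 0 \<noteq> 0" for a
  proof -
    have "0 \<in> Poly_Mapping.keys (v a)" using that by (simp add: in_keys_iff)
    then have "mdeg (0 :: 'v \<Rightarrow>\<^sub>0 nat) + shift F i a = j" using v
      unfolding hom_vec_def homog_def by blast
    then show ?thesis by (simp add: mdeg_def)
  qed
  then show ?thesis using v by (auto simp: fibre_part_def const_coeffs_def hom_vec_def free_mod_def)
qed

text \<open>Vectors over \<open>K\<close> lift to constant vectors over \<open>R\<close> of the same degree, so boundaries in the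
  fibre are reductions of homogeneous boundaries of \<open>F\<close>, and \<open>Tor\<close> can be handled inside \<open>F\<close>.\<close>

lemma tor_boundaries_eq:
  "tor_boundaries F i j = (\<lambda>u. const_coeffs (bd_map F i u)) ` hom_vec (Suc i) j"
proof (intro equalityI subsetI)
  fix z assume "z \<in> tor_boundaries F i j"
  then obtain y where y: "y \<in> fibre_part F (Suc i) j" "z = fibre_bd F i y"
    by (auto simp: tor_boundaries_def)
  then have "z = const_coeffs (bd_map F i (\<lambda>a. Poly_Mapping.single 0 (y a)))"
    by (simp add: fibre_bd_const_coeffs[symmetric] const_coeffs_single)
  with single_in_hom_vec[OF y(1)] show "z \<in> (\<lambda>u. const_coeffs (bd_map F i u)) ` hom_vec (Suc i) j"
    by blast
qed (auto simp: tor_boundaries_def fibre_bd_const_coeffs[symmetric] const_coeffs_in_fibre_part)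

lemma tor_boundaries_subset_cycles: "tor_boundaries F i j \<subseteq> tor_cycles F i j"
proof
  fix z assume "z \<in> tor_boundaries F i j"
  then obtain u where u: "u \<in> hom_vec (Suc i) j" "z = const_coeffs (bd_map F i u)"
    by (auto simp: tor_boundaries_eq)
  have "fibre_bd F i' z = 0" if "i = Suc i'" for i'
    using u bd_map_bd_map[of u i'] that by (simp add: fibre_bd_const_coeffs hom_vec_def)
  then show "z \<in> tor_cycles F i j"
    using u const_coeffs_in_fibre_part[OF bd_map_hom_vec[OF u(1)]]
    by (auto simp: tor_cycles_def split: nat.split)
qed

lemma tor_cycles_subset_free_mod: "tor_cycles F i j \<subseteq> free_mod (rank F i)"
  by (auto simp: tor_cycles_def fibre_part_def)

lemma tor_boundaries_subspace: "module.subspace (\<lambda>c v a. c * v a) (tor_boundaries F i j)"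
proof -
  interpret vector_space "\<lambda>(c::'k) (v::nat \<Rightarrow> 'k) a. c * v a" by (rule vector_space_fun)
  have add: "fibre_bd F i (u + v) = fibre_bd F i u + fibre_bd F i v" for u v
    by (simp add: fibre_bd_def mat_apply_add)
  have scale: "fibre_bd F i (\<lambda>a. c * v a) = (\<lambda>a. c * fibre_bd F i v a)" for c v
    using mat_apply_smul[of _ _ _ c v] by (simp add: fibre_bd_def smul_def)
  have add': "u + v \<in> fibre_part F (Suc i) j"
    if "u \<in> fibre_part F (Suc i) j" "v \<in> fibre_part F (Suc i) j" for u v
    using that by (force simp: fibre_part_def free_mod_def)
  have scale': "(\<lambda>a. c * v a) \<in> fibre_part F (Suc i) j" if "v \<in> fibre_part F (Suc i) j" for c v
    using that by (auto simp: fibre_part_def free_mod_def)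
  have zero: "0 \<in> fibre_part F (Suc i) j" by (simp add: fibre_part_def)
  have zero': "fibre_bd F i 0 = 0" by (simp add: fibre_bd_def mat_apply_def fun_eq_iff)
  show ?thesis
    unfolding subspace_def tor_boundaries_def
  proof (intro conjI ballI allI)
    show "0 \<in> fibre_bd F i ` fibre_part F (Suc i) j" using zero zero' by (metis imageI)
  next
    fix x y assume "x \<in> fibre_bd F i ` fibre_part F (Suc i) j"
        "y \<in> fibre_bd F i ` fibre_part F (Suc i) j"
    then obtain u v where "u \<in> fibre_part F (Suc i) j" "v \<in> fibre_part F (Suc i) j"
      "x = fibre_bd F i u" "y = fibre_bd F i v" by blast
    then show "x + y \<in> fibre_bd F i ` fibre_part F (Suc i) j"
      using add' by (intro image_eqI[of _ _ "u + v"]) (simp_all only: add)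
  next
    fix c x assume "x \<in> fibre_bd F i ` fibre_part F (Suc i) j"
    then obtain y where "y \<in> fibre_part F (Suc i) j" "x = fibre_bd F i y" by blast
    then show "(\<lambda>a. c * x a) \<in> fibre_bd F i ` fibre_part F (Suc i) j"
      using scale' by (intro image_eqI[of _ _ "\<lambda>a. c * y a"]) (simp_all only: scale)
  qed
qed

text \<open>With all \<open>n\<close> variables set to zero, a class in \<open>Tor\<^sub>n\<close> is a cycle modulo all variables and
  trivially killed by them. It descends to \<open>H\<^sub>0(F) = R/I\<close>, and its degree drops from \<open>j + n\<close> to
  \<open>j\<close>.\<close>

lemma socle_of_top_tor:
  assumes "tor_dim F CARD('v) (j + CARD('v)) \<noteq> 0"
  obtains f where "f \<in> homog 0 j" "f \<notin> I" "\<And>y. var y * f \<in> I"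
proof -
  let ?n = "CARD('v)"
  have "\<not> tor_cycles F ?n (j + ?n) \<subseteq> tor_boundaries F ?n (j + ?n)"
    using assms vec_dim_mono[of "tor_cycles F ?n (j + ?n)" "tor_boundaries F ?n (j + ?n)"
        "rank F ?n"]
      tor_boundaries_subset_cycles tor_cycles_subset_free_mod by (force simp: tor_dim_def)
  then obtain z where z: "z \<in> tor_cycles F ?n (j + ?n)" "z \<notin> tor_boundaries F ?n (j + ?n)" by blast
  define v where "v = (\<lambda>a. Poly_Mapping.single (0 :: 'v \<Rightarrow>\<^sub>0 nat) (z a))"
  have z_eq: "z = const_coeffs v" by (simp add: v_def const_coeffs_single)
  have hom: "v \<in> hom_vec ?n (j + ?n)"
    using z(1) unfolding v_def by (intro single_in_hom_vec) (simp add: tor_cycles_def)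
  have "cycle_mod UNIV ?n v"
    using z(1) by (auto simp: cycle_mod_def tor_cycles_def var_ideal_vec_UNIV_iff z_eq fibre_bd_const_coeffs)
  moreover have "\<not> boundary_mod UNIV ?n v"
  proof
    assume "boundary_mod UNIV ?n v"
    then obtain u where u: "u \<in> free_mod (rank F (Suc ?n))" "v - bd_map F ?n u \<in> var_ideal_vec UNIV"
      by (auto simp: boundary_mod_def)
    have "hom_proj ?n (j + ?n) (v - bd_map F ?n u) \<in> var_ideal_vec UNIV"
      by (rule hom_proj_var_ideal_vec[OF u(2)])
    then have "z = const_coeffs (bd_map F ?n (hom_proj (Suc ?n) (j + ?n) u))"
      by (simp only: hom_proj_diff hom_proj_id[OF hom] bd_map_hom_proj[symmetric]
          var_ideal_vec_UNIV_iff const_coeffs_diff z_eq right_minus_eq)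
    with hom_proj_in[OF u(1)] z(2) show False unfolding tor_boundaries_eq by blast
  qed
  moreover have "boundary_mod UNIV ?n (smul (var y) v)" for y
  proof -
    have "bd_map F ?n 0 = 0" by (simp add: bd_map_def mat_apply_def fun_eq_iff)
    then show ?thesis unfolding boundary_mod_def
      by (intro bexI[of _ 0]) (simp_all add: smul_var_in_var_ideal_vec)
  qed
  ultimately obtain w where w: "w \<in> hom_vec 0 j" "\<not> boundary_mod {} 0 w"
      "\<And>y. boundary_mod {} 0 (smul (var y) w)"
    using cycle_descends_to_socle[of UNIV v j] hom by auto
  have iff: "boundary_mod {} 0 u \<longleftrightarrow> aug_map F u \<in> I" if "u \<in> free_mod (rank F 0)" for u
    using aug_map_in_I_iff[OF that] by (simp add: boundary_mod_def)
  have "w \<in> free_mod (rank F 0)" using w(1) by (simp add: hom_vec_def)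
  then show ?thesis
    using that[of "aug_map F w"] w iff free_mod_smul[of w _ "var _"] aug_map_homog[OF w(1)]
    by (metis aug_map_smul)
qed

end


section \<open>The first Tor and the generators of the ideal\<close>

lemma single_0_mult_in_homog: "p \<in> homog s j \<Longrightarrow> Poly_Mapping.single 0 c * p \<in> homog s j"
  by (rule homog_mult[of _ s s]) (simp_all add: homog_def mdeg_def)

lemma lookup_single_0_mult:
    "Poly_Mapping.lookup (Poly_Mapping.single 0 c * p) m = c * Poly_Mapping.lookup p m"
  for p :: "('v::finite, 'k::field) mpoly"
  using lookup_single_mult[of 0 c p m] by simp

context graded_resolution
begin

text \<open>A boundary with coefficients without constant term is sent by the augmentation into the
  product of \<open>I\<close> with the ideal of all variables, which starts one degree later than \<open>I\<close>.\<close>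

lemma aug_bd_map_in_order_ge:
  assumes I: "I \<subseteq> order_ge j" and v: "v \<in> var_ideal_vec UNIV"
  shows "aug_map F (bd_map F 0 v) \<in> order_ge (Suc j)"
proof -
  \<comment> \<open>The composite of augmentation and differential sends the basis of \<open>F\<^sub>1\<close> to elements \<open>h b\<close> of
    \<open>I\<close>.\<close>
  define h where "h = (\<lambda>b. \<Sum>a<rank F 0. aug F a * bd F 0 a b)"
  have "h b \<in> I" if b: "b < rank F 1" for b
  proof -
    define e where "e = (\<lambda>c. if c = b then 1 else 0 :: ('v, 'k) mpoly)"
    have "e \<in> free_mod (rank F 1)" using b by (simp add: e_def free_mod_def)
    then have "aug_map F (bd_map F 0 e) \<in> I"
      using aug_map_in_I_iff[OF bd_map_in_free_mod] by blast
    moreover have "bd_map F 0 e a = bd F 0 a b" if "a < rank F 0" for a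
      using that b by (simp add: bd_map_def mat_apply_def e_def if_distrib sum.delta cong: if_cong)
    ultimately show ?thesis by (simp add: aug_map_def h_def)
  qed
  moreover have "v b \<in> order_ge 1" for b
    using v by (simp only: order_ge_1_iff) (simp add: var_ideal_vec_def var_ideal_UNIV_iff)
  ultimately have "h b * v b \<in> order_ge (j + 1)" if "b < rank F 1" for b
    using I that by (intro order_ge_mult) auto
  then have "(\<Sum>b<rank F 1. h b * v b) \<in> order_ge (Suc j)" by (auto intro: order_ge_sum)
  moreover have "aug_map F (bd_map F 0 v) =
      (\<Sum>a<rank F 0. \<Sum>b<rank F 1. aug F a * (bd F 0 a b * v b))"
    by (simp add: aug_map_def bd_map_def mat_apply_def sum_distrib_left)
  moreover have "\<dots> = (\<Sum>b<rank F 1. \<Sum>a<rank F 0. aug F a * (bd F 0 a b * v b))"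
    by (rule sum.swap)
  moreover have "\<dots> = (\<Sum>b<rank F 1. h b * v b)"
    by (simp add: h_def sum_distrib_right mult.assoc)
  ultimately show ?thesis by simp
qed

text \<open>In a non-minimal resolution \<open>F\<^sub>0\<close> may have several generators, so the unit of \<open>R/I\<close> has to
  be lifted explicitly.\<close>

lemma exists_lift_of_1:
  obtains e where "e \<in> hom_vec 0 0" "1 - aug_map F e \<in> I"
proof -
  obtain v where v: "v \<in> free_mod (rank F 0)" "1 - aug_map F v \<in> I" by (rule aug_map_surj)
  have "homog_part 0 0 (1 - aug_map F v) = 1 - aug_map F (hom_proj 0 0 v)"
    by (auto simp: aug_map_hom_proj intro!: poly_mapping_eqI
      simp: lookup_homog_part lookup_minus lookup_one mdeg_eq_0_iff when_def)
  with homog_part_in_I[OF v(2), of 0] show ?thesis using that hom_proj_in[OF v(1)] by metis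
qed

lemma bd_map_sum: "bd_map F i (\<Sum>b\<in>A. v b) = (\<Sum>b\<in>A. bd_map F i (v b))"
proof (induction A rule: infinite_finite_induct)
  case (insert b A)
  then show ?case by (simp only: sum.insert bd_map_add not_False_eq_True)
qed (simp_all add: bd_map_def mat_apply_def fun_eq_iff)

text \<open>If \<open>I\<close> vanishes below degree \<open>j\<close>, its degree \<open>j\<close> part embeds into \<open>Tor\<^sub>1\<close>: with \<open>e\<close> a lift
  of \<open>1\<close>, the vector \<open>g e\<close> is a boundary \<open>\<partial> y\<close>, and \<open>g\<close> is sent to the class of \<open>y\<close> modulo the
  variables. If that class vanishes, \<open>y\<close> may be taken without constant coefficients, so \<open>g\<close> lies
  in the product of \<open>I\<close> with the ideal of all variables, which is zero in degree \<open>j\<close>.\<close>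

lemma generators_le_tor_1:
  assumes I: "I \<subseteq> order_ge j" and j: "1 \<le> j" and fin: "finite N"
    and g: "\<And>i. i \<in> N \<Longrightarrow> g i \<in> I \<inter> homog 0 j"
    and indep: "\<And>c. (\<Sum>i\<in>N. Poly_Mapping.single 0 (c i) * g i) = 0 \<Longrightarrow> \<forall>i\<in>N. c i = 0"
  shows "card N \<le> tor_dim F 1 j"
proof -
  obtain e where e: "e \<in> hom_vec 0 0" "1 - aug_map F e \<in> I" by (rule exists_lift_of_1)
  have "\<exists>y. y \<in> hom_vec 1 j \<and> bd_map F 0 y = smul (g i) e" if i: "i \<in> N" for i
  proof -
    have "smul (g i) e \<in> hom_vec 0 j"
      using e(1) g[OF i] unfolding hom_vec_def smul_def
      by (auto simp: free_mod_def) (metis homog_mult mult.commute)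
    moreover have "aug_map F (smul (g i) e) \<in> I"
      unfolding aug_map_smul using ideal_mult[OF ideal_I, of "g i" "aug_map F e"] g[OF i]
      by (simp add: mult.commute)
    ultimately obtain u where u: "u \<in> free_mod (rank F 1)" "smul (g i) e = bd_map F 0 u"
      using aug_map_in_I_iff[of "smul (g i) e"] by (auto simp: hom_vec_def)
    have "bd_map F 0 (hom_proj 1 j u) = smul (g i) e"
      using bd_map_hom_proj[of 0 j u] u(2) hom_proj_id[OF \<open>smul (g i) e \<in> hom_vec 0 j\<close>] by simp
    with hom_proj_in[OF u(1)] show ?thesis by blast
  qed
  then obtain y where y: "\<And>i. i \<in> N \<Longrightarrow> y i \<in> hom_vec 1 j"
      "\<And>i. i \<in> N \<Longrightarrow> bd_map F 0 (y i) = smul (g i) e" by metis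
  have "vec_dim (tor_boundaries F 1 j) + card N \<le> vec_dim (tor_cycles F 1 j)"
  proof (rule vec_dim_add_card_le[OF tor_boundaries_subspace tor_boundaries_subset_cycles
        tor_cycles_subset_free_mod fin])
    fix i assume i: "i \<in> N"
    have "g i \<in> order_ge 1" using g[OF i] j by (auto simp: order_ge_def homog_def)
    then have "const_coeffs (smul (g i) e) = 0"
      by (simp only: order_ge_1_iff)
        (simp add: const_coeffs_def smul_def constant_coeff_mult fun_eq_iff)
    then show "const_coeffs (y i) \<in> tor_cycles F 1 j"
      using const_coeffs_in_fibre_part[OF y(1)[OF i]] y(2)[OF i]
      by (simp add: tor_cycles_def fibre_bd_const_coeffs)
  next
    fix c assume "(\<Sum>i\<in>N. (\<lambda>a. c i * const_coeffs (y i) a)) \<in> tor_boundaries F 1 j"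
    then obtain u where u: "u \<in> hom_vec 2 j"
        "(\<Sum>i\<in>N. (\<lambda>a. c i * const_coeffs (y i) a)) = const_coeffs (bd_map F 1 u)"
      by (auto simp: tor_boundaries_eq numeral_2_eq_2)
    define v where "v = (\<lambda>a. \<Sum>i\<in>N. Poly_Mapping.single 0 (c i) * y i a)"
    define p where "p = (\<Sum>i\<in>N. Poly_Mapping.single 0 (c i) * g i)"
    have "const_coeffs v = (\<Sum>i\<in>N. (\<lambda>a. c i * const_coeffs (y i) a))"
      by (simp add: v_def const_coeffs_def fun_eq_iff sum_fun_apply lookup_sum lookup_single_0_mult)
    then have "v - bd_map F 1 u \<in> var_ideal_vec UNIV"
      by (simp only: var_ideal_vec_UNIV_iff const_coeffs_diff u(2) diff_self)
    then have "aug_map F (bd_map F 0 (v - bd_map F 1 u)) \<in> order_ge (Suc j)"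
      by (rule aug_bd_map_in_order_ge[OF I])
    moreover have "bd_map F 0 (v - bd_map F 1 u) = smul p e"
    proof -
      have "v = (\<Sum>i\<in>N. smul (Poly_Mapping.single 0 (c i)) (y i))"
        by (simp add: v_def smul_def fun_eq_iff sum_fun_apply)
      then have "bd_map F 0 v = (\<Sum>i\<in>N. smul (Poly_Mapping.single 0 (c i)) (smul (g i) e))"
        using y(2) by (simp add: bd_map_sum bd_map_smul)
      also have "\<dots> = smul p e"
        by (simp add: p_def smul_def fun_eq_iff sum_fun_apply sum_distrib_right mult.assoc)
      finally show ?thesis
        using bd_map_bd_map[of u 0] u(1) by (simp add: bd_map_diff hom_vec_def numeral_2_eq_2)
    qed
    ultimately have 1: "p * aug_map F e \<in> order_ge (Suc j)" by (simp only: aug_map_smul)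
    have p: "p \<in> homog 0 j"
      unfolding p_def using g by (intro homog_sum single_0_mult_in_homog) auto
    have "p * (1 - aug_map F e) \<in> order_ge (j + j)"
      using p e(2) I by (intro order_ge_mult) (auto simp: homog_def order_ge_def)
    then have "p * (1 - aug_map F e) \<in> order_ge (Suc j)"
      using j by (fastforce simp: order_ge_def)
    from order_ge_add[OF 1 this] have "p \<in> order_ge (Suc j)" by (simp add: algebra_simps)
    with p have "p = 0" using order_ge_Suc_homog_eq_0 by blast
    then show "\<forall>i\<in>N. c i = 0" using indep by (simp add: p_def)
  qed
  then show ?thesis by (simp add: tor_dim_def)
qed

lemma order_ge_Suc_if_tor_1_eq_0:
  assumes I: "I \<subseteq> order_ge j" and j: "1 \<le> j" and tor: "tor_dim F 1 j = 0"
  shows "I \<subseteq> order_ge (Suc j)"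
proof
  fix p assume p: "p \<in> I"
  define g where "g = homog_part 0 j p"
  have "g = 0"
  proof (rule ccontr)
    assume "g \<noteq> 0"
    then obtain m where "Poly_Mapping.lookup g m \<noteq> 0" by (auto simp: poly_mapping_eq_iff fun_eq_iff)
    then have "c = 0" if "Poly_Mapping.single 0 c * g = 0" for c
      using that lookup_single_0_mult[of c g m] by simp
    then have "card {()} \<le> tor_dim F 1 j"
      using homog_part_in_I[OF p] homog_part_in[of 0 j p]
      by (intro generators_le_tor_1[OF I j, of _ "\<lambda>_. g"]) (auto simp: g_def)
    with tor show False by simp
  qed
  then have "Poly_Mapping.lookup p m = 0" if "mdeg m = j" for m
    using lookup_homog_part[of 0 j p m] that by (simp add: g_def)
  moreover have "p \<in> order_ge j" using p I by blast
  ultimately show "p \<in> order_ge (Suc j)"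
    unfolding order_ge_def mem_Collect_eq by (metis in_keys_iff le_neq_implies_less less_eq_Suc_le)
qed

text \<open>A homogeneous ideal that contains a polynomial with nonzero constant coefficient contains
  \<open>1\<close>.\<close>

lemma order_ge_1_if_proper:
  assumes "f \<notin> I"
  shows "I \<subseteq> order_ge 1"
proof
  fix p assume p: "p \<in> I"
  have "Poly_Mapping.lookup p 0 = 0"
  proof (rule ccontr)
    assume c: "Poly_Mapping.lookup p 0 \<noteq> 0"
    have "homog_part 0 0 p = Poly_Mapping.single 0 (Poly_Mapping.lookup p 0)"
      by (auto intro!: poly_mapping_eqI simp: lookup_homog_part mdeg_eq_0_iff lookup_single when_def)
    then have "Poly_Mapping.single 0 (Poly_Mapping.lookup p 0) \<in> I"
      using homog_part_in_I[OF p] by metis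
    then have "f * Poly_Mapping.single 0 (inverse (Poly_Mapping.lookup p 0)) *
        Poly_Mapping.single 0 (Poly_Mapping.lookup p 0) \<in> I"
      by (rule ideal_mult[OF ideal_I])
    with c have "f \<in> I" by (simp add: mult.assoc mult_single)
    with assms show False ..
  qed
  then show "p \<in> order_ge 1" by (simp only: order_ge_1_iff)
qed

end


section \<open>Multiples of a form by linear forms\<close>

lemma single_0_mult_var:
  "Poly_Mapping.single 0 c * var x = Poly_Mapping.single (Poly_Mapping.single x (Suc 0)) c"
  by (simp add: mult_single)

lemma linear_form_mult:
  "linear_form c * f = (\<Sum>x\<in>UNIV. Poly_Mapping.single 0 (c x) * (var x * f))"
  by (simp add: linear_form_def sum_distrib_right mult.assoc[symmetric] single_0_mult_var)

text \<open>Among the monomials \<open>m\<close> of \<open>f\<close>, take one with the highest exponent of \<open>x\<close>. The coefficient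
  of the product at \<open>x m\<close> is then \<open>c x\<close> times that of \<open>f\<close> at \<open>m\<close>, since the other variables do not
  raise the exponent of \<open>x\<close>.\<close>

lemma linear_form_mult_eq_0D:
  fixes f :: "('v::finite, 'k::field) mpoly"
  assumes "linear_form c * f = 0" and "f \<noteq> 0"
  shows "c x = 0"
proof -
  define h where "h = (\<lambda>m :: 'v \<Rightarrow>\<^sub>0 nat. Poly_Mapping.lookup m x)"
  have "Max (h ` Poly_Mapping.keys f) \<in> h ` Poly_Mapping.keys f"
    using assms(2) by (intro Max_in) simp_all
  then obtain m where m: "m \<in> Poly_Mapping.keys f" "h m = Max (h ` Poly_Mapping.keys f)" by force
  have max: "h m' \<le> h m" if "m' \<in> Poly_Mapping.keys f" for m'
    unfolding m(2) using that by (intro Max_ge) simp_all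
  define M where "M = Poly_Mapping.single x (Suc 0) + m"
  have "Poly_Mapping.lookup (Poly_Mapping.single (Poly_Mapping.single y (Suc 0)) (c y) * f) M =
      0" if "y \<noteq> x" for y
  proof (rule ccontr)
    assume "\<not> ?thesis"
    then have "M \<in> Poly_Mapping.keys (Poly_Mapping.single (Poly_Mapping.single y (Suc 0)) (c y) *
        f)"
      by (simp add: in_keys_iff)
    then obtain m' where m': "m' \<in> Poly_Mapping.keys f" "M = Poly_Mapping.single y (Suc 0) + m'"
      using keys_mult[of "Poly_Mapping.single (Poly_Mapping.single y (Suc 0)) (c y)" f]
      by (auto split: if_splits)
    then have "h M = h m'" using that by (simp add: h_def lookup_add lookup_single)
    moreover have "h M = Suc (h m)" by (simp add: h_def M_def lookup_add)
    ultimately show False using max[OF m'(1)] by simp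
  qed
  then have "Poly_Mapping.lookup (linear_form c * f) M =
      (\<Sum>y\<in>{x}. Poly_Mapping.lookup (Poly_Mapping.single (Poly_Mapping.single y (Suc 0)) (c y) *
          f) M)"
    unfolding linear_form_def sum_distrib_right lookup_sum One_nat_def
    by (intro sum.mono_neutral_right) auto
  also have "\<dots> = c x * Poly_Mapping.lookup f m" by (simp add: M_def lookup_single_mult)
  finally show ?thesis using assms(1) m(1) by (simp add: in_keys_iff)
qed

text \<open>Otherwise \<open>g\<close> and the products \<open>x f\<close> would be \<open>n + 1\<close> linearly independent elements of \<open>I\<close>
  in degree \<open>d + 1\<close>, more than the first \<open>Tor\<close> admits.\<close>

lemma (in graded_resolution) next_degree_eq_linear_multiples:
  assumes I: "I \<subseteq> order_ge (Suc d)" and tor: "tor_dim F 1 (Suc d) \<le> CARD('v)"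
    and f: "f \<in> homog 0 d" "f \<noteq> 0" "\<And>x. var x * f \<in> I"
    and g: "g \<in> I" "g \<in> homog 0 (Suc d)"
  obtains c where "g = linear_form c * f"
proof (rule ccontr)
  assume "\<not> thesis"
  then have no: "g \<noteq> linear_form c * f" for c using that by blast
  \<comment> \<open>The family of \<open>n + 1\<close> elements is indexed by \<open>'v option\<close>, with \<open>g\<close> at \<open>None\<close>.\<close>
  define G where "G = (\<lambda>i. case i of None \<Rightarrow> g | Some x \<Rightarrow> var x * f)"
  have "card (UNIV :: 'v option set) \<le> tor_dim F 1 (Suc d)"
  proof (rule generators_le_tor_1[OF I])
    show "G i \<in> I \<inter> homog 0 (Suc d)" for i
      using f g homog_mult[of "var _" 0 1 f "Suc d"] homog_mult[OF f(1) var_in_homog]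
      by (simp add: G_def mult.commute split: option.split)
  next
    fix c :: "'v option \<Rightarrow> 'k"
    assume 0: "(\<Sum>i\<in>UNIV. Poly_Mapping.single 0 (c i) * G i) = 0"
    have rel: "Poly_Mapping.single 0 (c None) * g + linear_form (\<lambda>x. c (Some x)) * f = 0"
      using 0 unfolding UNIV_option_conv linear_form_mult
      by (subst (asm) sum.insert) (simp_all add: G_def sum.reindex)
    have None: "c None = 0"
    proof (rule ccontr)
      assume c: "c None \<noteq> 0"
      have "g = Poly_Mapping.single 0 (inverse (c None)) * (Poly_Mapping.single 0 (c None) * g)"
        using c by (simp add: mult.assoc[symmetric] mult_single)
      also have "\<dots> =
          Poly_Mapping.single 0 (- inverse (c None)) * (linear_form (\<lambda>x. c (Some x)) * f)"
        using rel by (simp add: eq_neg_iff_add_eq_0[symmetric] single_uminus)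
      also have "\<dots> = linear_form (\<lambda>x. - inverse (c None) * c (Some x)) * f"
        by (simp only: linear_form_def sum_distrib_left mult.assoc[symmetric] mult_single add_0)
      finally show False using no by blast
    qed
    with rel have "c (Some x) = 0" for x
      using linear_form_mult_eq_0D[of "\<lambda>x. c (Some x)" f x] f(2) by simp
    with None show "\<forall>i\<in>UNIV. c i = 0" by (metis option.exhaust)
  qed simp_all
  with tor show False by (simp add: card_UNIV_option)
qed


section \<open>Restriction to an affine line in a hyperplane\<close>

definition poly_subst :: "('v::finite \<Rightarrow> 'k::field poly) \<Rightarrow> ('v, 'k) mpoly \<Rightarrow> 'k poly" where
  "poly_subst u p =
     (\<Sum>m\<in>Poly_Mapping.keys p. smult (Poly_Mapping.lookup p m) (\<Prod>x\<in>UNIV. u x ^ Poly_Mapping.lookup m x))"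

lemma poly_subst_superset:
  assumes "finite A" and "Poly_Mapping.keys p \<subseteq> A"
  shows "poly_subst u p =
    (\<Sum>m\<in>A. smult (Poly_Mapping.lookup p m) (\<Prod>x\<in>UNIV. u x ^ Poly_Mapping.lookup m x))"
  unfolding poly_subst_def using assms
  by (intro sum.mono_neutral_left) (auto simp: in_keys_iff)

lemma poly_subst_add: "poly_subst u (p + q) = poly_subst u p + poly_subst u q"
  using poly_subst_superset[of "Poly_Mapping.keys p \<union> Poly_Mapping.keys q" p u]
    poly_subst_superset[of "Poly_Mapping.keys p \<union> Poly_Mapping.keys q" q u]
    poly_subst_superset[of "Poly_Mapping.keys p \<union> Poly_Mapping.keys q" "p + q" u] keys_add[of p q]
  by (simp add: lookup_add smult_add_left sum.distrib)

lemma poly_subst_0 [simp]: "poly_subst u 0 = 0"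
  by (simp add: poly_subst_def)

lemma poly_subst_sum: "poly_subst u (sum f A) = (\<Sum>a\<in>A. poly_subst u (f a))"
  by (induction A rule: infinite_finite_induct) (auto simp: poly_subst_add)

lemma poly_subst_single:
  "poly_subst u (Poly_Mapping.single m c) = smult c (\<Prod>x\<in>UNIV. u x ^ Poly_Mapping.lookup m x)"
  by (simp add: poly_subst_def)

lemma poly_subst_mult: "poly_subst u (p * q) = poly_subst u p * poly_subst u q"
proof (induction p rule: mpoly_induct)
  case (single m c)
  show ?case
  proof (induction q rule: mpoly_induct)
    case (single m' c')
    show ?case
      by (simp add: mult_single poly_subst_single lookup_add power_add prod.distrib mult.commute)
  qed (simp only: distrib_left poly_subst_add)
qed (auto simp: distrib_right poly_subst_add)

lemma poly_subst_var: "poly_subst u (var x) = u x"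
proof -
  have "(\<Prod>y\<in>UNIV. u y ^ Poly_Mapping.lookup (Poly_Mapping.single x (Suc 0)) y) =
      (\<Prod>y\<in>{x}. u y ^ Poly_Mapping.lookup (Poly_Mapping.single x (Suc 0)) y)"
    by (rule prod.mono_neutral_right) (auto simp: lookup_single)
  then show ?thesis by (simp add: poly_subst_single)
qed

lemma poly_subst_power: "poly_subst u (p ^ n) = poly_subst u p ^ n"
  by (induction n) (simp_all add: poly_subst_mult, simp add: poly_subst_def)

lemma poly_subst_linear_form: "poly_subst u (linear_form c) = (\<Sum>x\<in>UNIV. smult (c x) (u x))"
proof -
  have "poly_subst u (Poly_Mapping.single (Poly_Mapping.single x (Suc 0)) (c x)) =
      smult (c x) (u x)" for x
    using poly_subst_mult[of u "Poly_Mapping.single 0 (c x)" "var x"]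
    by (simp add: single_0_mult_var poly_subst_var) (simp add: poly_subst_single)
  then show ?thesis by (simp add: linear_form_def poly_subst_sum)
qed

text \<open>The values of \<open>u\<close> parametrise the affine line on which \<open>x = 1\<close>, \<open>y = t\<close>, a third coordinate
  \<open>x0\<close> is determined by the equation \<open>\<Sum> a\<^sub>z z = 0\<close>, and all other coordinates vanish. Three
  variables are needed to choose \<open>x\<close> and \<open>y\<close> different from \<open>x0\<close>.\<close>

lemma exists_line_in_hyperplane:
  fixes a :: "'v::finite \<Rightarrow> 'k::field"
  assumes "CARD('v) \<ge> 3"
  obtains u x y where "poly_subst u (linear_form a) = 0" "u x = 1" "u y = [:0, 1:]"
    "\<And>z. degree (u z) \<le> 1"
proof -
  \<comment> \<open>If \<open>a = 0\<close>, any \<open>x0\<close> will do: division by \<open>a x0 = 0\<close> gives \<open>0\<close> below.\<close>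
  have "\<exists>x0. (\<exists>x. a x \<noteq> 0) \<longrightarrow> a x0 \<noteq> 0" by blast
  then obtain x0 where x0: "\<And>x. a x \<noteq> 0 \<Longrightarrow> a x0 \<noteq> 0" by blast
  have "card (UNIV - {x0} :: 'v set) \<ge> 2" using assms by (simp add: card_Diff_singleton)
  then obtain S :: "'v set" where "S \<subseteq> UNIV - {x0}" "card S = 2"
    by (rule obtain_subset_with_card_n)
  then obtain x y where xy: "x \<noteq> x0" "y \<noteq> x0" "x \<noteq> y"
    unfolding card_2_iff by blast
  define u where "u = (\<lambda>z. if z = x then 1 else if z = y then [:0, 1:]
      else if z = x0 then [:- a x / a x0, - a y / a x0:] else 0)"
  have "(\<Sum>z\<in>UNIV. smult (a z) (u z)) = (\<Sum>z\<in>{x0, x, y}. smult (a z) (u z))"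
    by (rule sum.mono_neutral_right) (auto simp: u_def)
  also have "\<dots> = 0"
    using xy x0[of x] x0[of y] by (cases "a x0 = 0") (auto simp: u_def one_pCons)
  finally show ?thesis
    using xy by (intro that[of u x y]) (auto simp: poly_subst_linear_form u_def)
qed


section \<open>Failure of the Weak Lefschetz Property\<close>

theorem theorem2:
  fixes I :: "('v::finite, 'k::field) mpoly set" and n d :: nat
  assumes "n \<ge> 3" and "d \<ge> 1"
    and "homogeneous_ideal I"
    and "has_maximal_koszul_tail I n d"
  shows "\<not> weak_lefschetz I
    \<and> for_general_linear_form (\<lambda>l. \<not> mult_full_rank I d l)
    \<and> \<not> for_general_linear_form (\<lambda>l. mult_full_rank I d l)"
proof -
  obtain T F where n: "n = CARD('v)" and res: "graded_free_resolution I F"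
    and T: "\<And>i j. T j i = tor_dim F i (i + j)" and tail: "koszul_tail n d T"
    using assms(4) by (auto simp: has_maximal_koszul_tail_def is_betti_table_def)
  interpret graded_resolution I F by unfold_locales (fact assms(3), fact res)
  have "tor_dim F CARD('v) (d + CARD('v)) = T d n" using T[of d n] n by (simp add: add.commute)
  also have "\<dots> = 1" using tail assms(1) by (simp add: koszul_tail_def)
  finally obtain f where f: "f \<in> homog 0 d" "f \<notin> I" "\<And>x. var x * f \<in> I"
    using socle_of_top_tor[of d] by auto
  have ord: "I \<subseteq> order_ge (Suc k)" if "k \<le> d" for k
    using that
  proof (induction k)
    case 0
    show ?case using order_ge_1_if_proper[OF f(2)] by simp
  next
    case (Suc k)
    have "T k 1 = 0" using tail assms(1) Suc.prems by (cases k) (auto simp: koszul_tail_def)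
    then have "tor_dim F 1 (Suc k) = 0" using T[of k 1] by simp
    moreover have "I \<subseteq> order_ge (Suc k)" using Suc by simp
    ultimately show ?case by (auto dest: order_ge_Suc_if_tor_1_eq_0)
  qed
  have "T d 1 = n" using tail assms(1) by (simp add: koszul_tail_def)
  then have tor: "tor_dim F 1 (Suc d) \<le> CARD('v)" using T[of d 1] n by simp
  have "f \<noteq> 0" using f(2) ideal_0[OF ideal_I] by blast
  have no: "\<not> mult_full_rank I d (linear_form a)" for a
  proof -
    define l :: "('v, 'k) mpoly" where "l = linear_form a"
    define m where "m = (\<lambda>X. residue_class I l \<otimes>\<^bsub>quot_ring I\<^esub> X)"
    have m: "m (residue_class I p) = residue_class I (l * p)" for p
      by (simp add: m_def residue_class_mult[OF ideal_I])
    have "\<not> inj_on m (quot_part I d)"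
    proof
      assume inj: "inj_on m (quot_part I d)"
      have "l * f \<in> I"
        unfolding l_def linear_form_mult by (intro ideal_sum[OF ideal_I] ideal_mult[OF ideal_I] f)
      then have "m (residue_class I f) = m (residue_class I 0)"
        unfolding m by (simp add: residue_class_eq_iff[OF ideal_I])
      moreover have "residue_class I f \<in> quot_part I d" "residue_class I 0 \<in> quot_part I d"
        using f(1) by (auto simp: quot_part_def graded_part_eq_homog)
      ultimately have "residue_class I f = residue_class I 0" using inj by (simp add: inj_on_eq_iff)
      with f(2) show False by (simp add: residue_class_eq_iff[OF ideal_I])
    qed
    moreover have "m ` quot_part I d \<noteq> quot_part I (Suc d)"
    proof
      assume surj: "m ` quot_part I d = quot_part I (Suc d)"
      \<comment> \<open>Restriction to the line kills \<open>l\<close>, so surjectivity turns into divisibility by the image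
        of \<open>f\<close>.\<close>
      obtain u x y where u: "poly_subst u l = 0" "u x = 1" "u y = [:0, 1:]" "\<And>z. degree (u z) \<le> 1"
        using exists_line_in_hyperplane[of a] assms(1) n unfolding l_def by metis
      have dvd: "\<exists>h. poly_subst u g = poly_subst u f * h \<and> degree h \<le> 1" if g:
          "g \<in> homog 0 (Suc d)" for g
      proof -
        have "residue_class I g \<in> m ` quot_part I d"
          unfolding surj using g by (auto simp: quot_part_def graded_part_eq_homog)
        then obtain p where p: "p \<in> homog 0 d" "residue_class I g = residue_class I (l * p)"
          by (auto simp: quot_part_def graded_part_eq_homog m)
        have "l \<in> homog 0 1"
          unfolding l_def linear_form_def by (intro homog_sum) (simp add: homog_def mdeg_single)
        then have lp: "l * p \<in> homog 0 (Suc d)"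
          using homog_mult[OF p(1), of l "Suc d"] by (auto simp: homog_def mult.commute)
        obtain c where c: "g - l * p = linear_form c * f"
        proof (rule next_degree_eq_linear_multiples[OF ord[OF order_refl] tor f(1) \<open>f \<noteq> 0\<close> f(3)])
          show "g - l * p \<in> I" using p(2) by (simp add: residue_class_eq_iff[OF ideal_I])
          show "g - l * p \<in> homog 0 (Suc d)" using g lp by (rule homog_diff)
        qed
        have "g = linear_form c * f + l * p" using c by (simp add: algebra_simps)
        then have "poly_subst u g = poly_subst u f * poly_subst u (linear_form c)"
          using u(1) by (simp add: poly_subst_add poly_subst_mult)
        moreover have "degree (poly_subst u (linear_form c)) \<le> 1"
          unfolding poly_subst_linear_form
          by (rule degree_sum_le) (simp_all only: finite order_trans[OF degree_smult_le u(4)])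
        ultimately show ?thesis by blast
      qed
      have pow: "var z ^ k \<in> homog 0 k" for z :: 'v and k
      proof (induction k)
        case (Suc k)
        then show ?case unfolding power_Suc2 by (rule homog_mult[OF _ var_in_homog])
      qed (simp add: homog_def mdeg_def)
      \<comment> \<open>On the line, the powers of \<open>x\<close> and \<open>y\<close> of degree \<open>d + 1\<close> become \<open>1\<close> and \<open>t\<^bsup>d+1\<^esup>\<close>.\<close>
      obtain h1 where h1: "1 = poly_subst u f * h1"
        using dvd[OF pow[of x]] unfolding poly_subst_power poly_subst_var u(2) power_one by blast
      obtain h2 where h2: "[:0, 1:] ^ Suc d = poly_subst u f * h2" "degree h2 \<le> 1"
        using dvd[OF pow[of y]] unfolding poly_subst_power poly_subst_var u(3) by blast
      have "degree (poly_subst u f) = 0"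
        using h1 by (metis dvdI is_unit_iff_degree not_is_unit_0)
      then have "degree ([:0, 1:] ^ Suc d :: 'k poly) \<le> 1"
        using h2 degree_mult_le[of "poly_subst u f" h2] by simp
      then show False using assms(2) by (simp add: degree_power_eq)
    qed
    ultimately show ?thesis by (simp add: mult_full_rank_def l_def m_def Let_def)
  qed
  have "zariski_open (UNIV :: ('v \<Rightarrow> 'k) set)"
    unfolding zariski_open_def by (rule exI[of _ "{1}"]) (simp add: mpoly_eval_def)
  then have "for_general_linear_form (\<lambda>l. \<not> mult_full_rank I d l)"
    unfolding for_general_linear_form_def using no by (intro exI[of _ UNIV]) simp
  moreover have "\<not> for_general_linear_form (\<lambda>l. mult_full_rank I d l)"
    unfolding for_general_linear_form_def using no by blast
  moreover have "\<not> weak_lefschetz I"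
    unfolding weak_lefschetz_def for_general_linear_form_def using no by blast
  ultimately show ?thesis by blast
qed

end
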